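(* Let $\mathcal H$ and $\mathcal G$ be real Hilbert spaces, let $\mathcal K=\mathcal H\oplus\mathcal G$, let $A\colon\mathcal H\to 2^{\mathcal H}$ and $B\colon\mathcal G\to 2^{\mathcal G}$ be maximally monotone, let $L\colon\mathcal H\to\mathcal G$ be a bounded linear operator, and let $(x_0,v_0^* )\in\mathcal K$. Assume that there exists $x\in\mathcal H$ such that $0\in Ax+L^*BLx$. Let $$Z=\{(x,v^* )\in\mathcal K : -L^*v^*\in Ax\ \text{and}\ Lx\in B^{-1}v^*\}$$ and let $(\overline x,\overline v^* )$ be the projection of $(x_0,v_0^* )$ onto $Z$. Let $\varepsilon\in\,]0,1[$ and iterate for $n=0,1,\ldots$: 1. Take any $(\gamma_n,\mu_n)\in[\varepsilon,1/\varepsilon]^2$; set $a_n=J_{\gamma_nA}(x_n-\gamma_nL^*v_n^* )$, $l_n=Lx_n$, $b_n=J_{\mu_nB}(l_n+\mu_nv_n^* )$, $s_n^*=\gamma_n^{-1}(x_n-a_n)+\mu_n^{-1}L^*(l_n-b_n)$, $t_n=b_n-La_n$, $\tau_n=\|s_n^*\|^2+\|t_n\|^2$. 2. If $\tau_n=0$, set $\theta_n=0$. If $\tau_n>0$, take any $\lambda_n\in[\varepsilon,1]$ and set $\theta_n=\lambda_n\big(\gamma_n^{-1}\|x_n-a_n\|^2+\mu_n^{-1}\|l_n-b_n\|^2\big)/\tau_n$. 3. Set $x_{n+1/2}=x_n-\theta_ns_n^*$ and $v_{n+1/2}^*=v_n^*-\theta_nt_n$. 4. Set $\chi_n=\langle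 x_0-x_n\mid x_n-x_{n+1/2}\rangle+\langle v_0^*-v_n^*\mid v_n^*-v_{n+1/2}^*\rangle$, $\omega_n=\|x_0-x_n\|^2+\|v_0^*-v_n^*\|^2$, $\nu_n=\|x_n-x_{n+1/2}\|^2+\|v_n^*-v_{n+1/2}^*\|^2$, $\rho_n=\omega_n\nu_n-\chi_n^2$. 5. If $\rho_n=0$ and $\chi_n\geq0$, set $x_{n+1}=x_{n+1/2}$ and $v_{n+1}^*=v_{n+1/2}^*$. If $\rho_n>0$ and $\chi_n\nu_n\geq\rho_n$, set $x_{n+1}=x_0+(1+\chi_n/\nu_n)(x_{n+1/2}-x_n)$ and $v_{n+1}^*=v_0^*+(1+\chi_n/\nu_n)(v_{n+1/2}^*-v_n^* )$. If $\rho_n>0$ and $\chi_n\nu_n<\rho_n$, set $x_{n+1}=x_n+(\nu_n/\rho_n)\big(\chi_n(x_0-x_n)+\omega_n(x_{n+1/2}-x_n)\big)$ and $v_{n+1}^*=v_n^*+(\nu_n/\rho_n)\big(\chi_n(v_0^*-v_n^* )+\omega_n(v_{n+1/2}^*-v_n^* )\big)$. Then this algorithm generates infinite sequences $(x_n)_{n\in\mathbb N}$ and $(v_n^* )_{n\in\mathbb N}$ (that is, at every iteration one of the three cases of step 5 applies), and the following hold: (i) $\sum_{n\in\mathbb N}\|x_{n+1}-x_n\|^2<+\infty$ and $\sum_{n\in\mathbb N}\|v_{n+1}^*-v_n^*\|^2<+\infty$. (ii) $\sum_{n\in\mathbb N}\|s_n^*\|^2<+\infty$ and $\sum_{n\in\mathbb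 N}\|t_n\|^2<+\infty$. (iii) $\sum_{n\in\mathbb N}\|x_n-a_n\|^2<+\infty$ and $\sum_{n\in\mathbb N}\|Lx_n-b_n\|^2<+\infty$. (iv) $x_n\to\overline x$ and $v_n^*\to\overline v^*$ (strong convergence).
   Context: $\mathcal H\oplus\mathcal G$ is the Hilbert direct sum. For a set-valued operator $A\colon\mathcal H\to2^{\mathcal H}$, $\operatorname{gra}A=\{(x,u): u\in Ax\}$ and $A^{-1}$ is the set-valued inverse ($x\in A^{-1}u\Leftrightarrow u\in Ax$). $A$ is monotone if $\langle x-y\mid u-v\rangle\geq0$ for all $(x,u),(y,v)\in\operatorname{gra}A$, and maximally monotone if moreover its graph is not properly contained in the graph of another monotone operator. $J_A=(\mathrm{Id}+A)^{-1}$ is the resolvent of $A$, which is single-valued and defined everywhere when $A$ is maximally monotone. $L^*$ is the adjoint of $L$, and $L^*BLx=\{L^*v : v\in B(Lx)\}$. The set $Z$ (Kuhn-Tucker set) is known to be nonempty, closed and convex under the stated assumptions, so the projection $(\overline x,\overline v^* )$ is well defined. *)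

theory Defs
  imports "HOL-Analysis.Analysis" "HOL-Library.Set_Algebras"
begin

text \<open>
  A set-valued operator from \<open>'a\<close> to \<open>'b\<close> is a function \<open>'a \<Rightarrow> 'b set\<close>. A real Hilbert space is a
  type of sort \<open>{real_inner, complete_space}\<close>; the product type \<open>'h \<times> 'g\<close> carries the inner
  product of the Hilbert direct sum. Sums of sets are Minkowski sums.
\<close>

definition gra :: "('a \<Rightarrow> 'b set) \<Rightarrow> ('a \<times> 'b) set" where
  "gra A = {(x, u). u \<in> A x}"

definition op_inverse :: "('a \<Rightarrow> 'b set) \<Rightarrow> 'b \<Rightarrow> 'a set" where
  "op_inverse A u = {x. u \<in> A x}"

definition op_scale :: "real \<Rightarrow> ('a \<Rightarrow> 'b::real_vector set) \<Rightarrow> 'a \<Rightarrow> 'b set" where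
  "op_scale c A x = (\<lambda>u. c *\<^sub>R u) ` A x"

definition monotone_op :: "('a::real_inner \<Rightarrow> 'a set) \<Rightarrow> bool" where
  "monotone_op A \<longleftrightarrow>
     (\<forall>(x, u) \<in> gra A. \<forall>(y, v) \<in> gra A. 0 \<le> (x - y) \<bullet> (u - v))"

definition maximally_monotone :: "('a::real_inner \<Rightarrow> 'a set) \<Rightarrow> bool" where
  "maximally_monotone A \<longleftrightarrow>
     monotone_op A \<and> \<not> (\<exists>A'. monotone_op A' \<and> gra A \<subset> gra A')"

definition resolvent :: "('a::real_vector \<Rightarrow> 'a set) \<Rightarrow> 'a \<Rightarrow> 'a set" where
  "resolvent A = op_inverse (\<lambda>x. {x} + A x)"

text \<open>
  The value of a single-valued resolvent; arbitrary where \<open>resolvent A x\<close> is not a singleton.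
\<close>

definition resolvent_fun :: "('a::real_vector \<Rightarrow> 'a set) \<Rightarrow> 'a \<Rightarrow> 'a" where
  "resolvent_fun A x = the_elem (resolvent A x)"

definition kuhn_tucker_set ::
  "('h::real_inner \<Rightarrow> 'h set) \<Rightarrow> ('g::real_inner \<Rightarrow> 'g set) \<Rightarrow> ('h \<Rightarrow> 'g) \<Rightarrow> ('h \<times> 'g) set" where
  "kuhn_tucker_set A B L =
     {(x, v). - adjoint L v \<in> A x \<and> L x \<in> op_inverse B v}"

text \<open>
  The library's \<open>closest_point\<close> needs the Heine--Borel property, hence finite dimension.
\<close>

definition projection :: "'a::metric_space set \<Rightarrow> 'a \<Rightarrow> 'a" where
  "projection S z = (THE p. p \<in> S \<and> (\<forall>q\<in>S. dist z p \<le> dist z q))"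

text \<open>
  The quantities computed in one iteration, as functions of the current iterate \<open>(x, v)\<close> and of
  the parameters \<open>\<gamma>\<close>, \<open>\<mu>\<close>, \<open>lam\<close> chosen in that iteration. The variable \<open>v\<close> stands for the dual
  iterate \<open>v\<^sup>*\<close>.
\<close>

definition pt_a ::
  "('h::real_inner \<Rightarrow> 'h set) \<Rightarrow> ('h \<Rightarrow> 'g::real_inner) \<Rightarrow> real \<Rightarrow> 'h \<Rightarrow> 'g \<Rightarrow> 'h" where
  "pt_a A L \<gamma> x v = resolvent_fun (op_scale \<gamma> A) (x - \<gamma> *\<^sub>R adjoint L v)"

definition pt_b ::
  "('g::real_inner \<Rightarrow> 'g set) \<Rightarrow> ('h::real_inner \<Rightarrow> 'g) \<Rightarrow> real \<Rightarrow> 'h \<Rightarrow> 'g \<Rightarrow> 'g" where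
  "pt_b B L \<mu> x v = resolvent_fun (op_scale \<mu> B) (L x + \<mu> *\<^sub>R v)"

definition dir_s ::
  "('h::real_inner \<Rightarrow> 'h set) \<Rightarrow> ('g::real_inner \<Rightarrow> 'g set) \<Rightarrow> ('h \<Rightarrow> 'g) \<Rightarrow>
   real \<Rightarrow> real \<Rightarrow> 'h \<Rightarrow> 'g \<Rightarrow> 'h" where
  "dir_s A B L \<gamma> \<mu> x v =
     inverse \<gamma> *\<^sub>R (x - pt_a A L \<gamma> x v) + inverse \<mu> *\<^sub>R adjoint L (L x - pt_b B L \<mu> x v)"

definition dir_t ::
  "('h::real_inner \<Rightarrow> 'h set) \<Rightarrow> ('g::real_inner \<Rightarrow> 'g set) \<Rightarrow> ('h \<Rightarrow> 'g) \<Rightarrow>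
   real \<Rightarrow> real \<Rightarrow> 'h \<Rightarrow> 'g \<Rightarrow> 'g" where
  "dir_t A B L \<gamma> \<mu> x v = pt_b B L \<mu> x v - L (pt_a A L \<gamma> x v)"

definition tau ::
  "('h::real_inner \<Rightarrow> 'h set) \<Rightarrow> ('g::real_inner \<Rightarrow> 'g set) \<Rightarrow> ('h \<Rightarrow> 'g) \<Rightarrow>
   real \<Rightarrow> real \<Rightarrow> 'h \<Rightarrow> 'g \<Rightarrow> real" where
  "tau A B L \<gamma> \<mu> x v = (norm (dir_s A B L \<gamma> \<mu> x v))\<^sup>2 + (norm (dir_t A B L \<gamma> \<mu> x v))\<^sup>2"

definition theta ::
  "('h::real_inner \<Rightarrow> 'h set) \<Rightarrow> ('g::real_inner \<Rightarrow> 'g set) \<Rightarrow> ('h \<Rightarrow> 'g) \<Rightarrow>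
   real \<Rightarrow> real \<Rightarrow> real \<Rightarrow> 'h \<Rightarrow> 'g \<Rightarrow> real" where
  "theta A B L \<gamma> \<mu> lam x v =
     (if tau A B L \<gamma> \<mu> x v = 0 then 0
      else lam * (inverse \<gamma> * (norm (x - pt_a A L \<gamma> x v))\<^sup>2
              + inverse \<mu> * (norm (L x - pt_b B L \<mu> x v))\<^sup>2)
           / tau A B L \<gamma> \<mu> x v)"

definition half_step ::
  "('h::real_inner \<Rightarrow> 'h set) \<Rightarrow> ('g::real_inner \<Rightarrow> 'g set) \<Rightarrow> ('h \<Rightarrow> 'g) \<Rightarrow>
   real \<Rightarrow> real \<Rightarrow> real \<Rightarrow> 'h \<times> 'g \<Rightarrow> 'h \<times> 'g" where
  "half_step A B L \<gamma> \<mu> lam = (\<lambda>(x, v).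
     (x - theta A B L \<gamma> \<mu> lam x v *\<^sub>R dir_s A B L \<gamma> \<mu> x v,
      v - theta A B L \<gamma> \<mu> lam x v *\<^sub>R dir_t A B L \<gamma> \<mu> x v))"

text \<open>
  The update from \<open>(x\<^sub>n, v\<^sub>n)\<close> and \<open>(xh, vh) = (x\<^bsub>n+1/2\<^esub>, v\<^bsub>n+1/2\<^esub>)\<close> to
  \<open>(x\<^bsub>n+1\<^esub>, v\<^bsub>n+1\<^esub>)\<close>. The result \<open>None\<close> means that none of the three cases applies, so that the
  algorithm is stuck.
\<close>

definition anchored_update ::
  "'h::real_inner \<times> 'g::real_inner \<Rightarrow> 'h \<times> 'g \<Rightarrow> 'h \<times> 'g \<Rightarrow> ('h \<times> 'g) option" where
  "anchored_update = (\<lambda>(x0, v0) (x, v) (xh, vh).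
     let chi = (x0 - x) \<bullet> (x - xh) + (v0 - v) \<bullet> (v - vh);
         \<omega> = (norm (x0 - x))\<^sup>2 + (norm (v0 - v))\<^sup>2;
         \<nu> = (norm (x - xh))\<^sup>2 + (norm (v - vh))\<^sup>2;
         \<rho> = \<omega> * \<nu> - chi\<^sup>2
     in if \<rho> = 0 \<and> chi \<ge> 0 then Some (xh, vh)
        else if \<rho> > 0 \<and> chi * \<nu> \<ge> \<rho> then
          Some (x0 + (1 + chi / \<nu>) *\<^sub>R (xh - x), v0 + (1 + chi / \<nu>) *\<^sub>R (vh - v))
        else if \<rho> > 0 \<and> chi * \<nu> < \<rho> then
          Some (x + (\<nu> / \<rho>) *\<^sub>R (chi *\<^sub>R (x0 - x) + \<omega> *\<^sub>R (xh - x)),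
                v + (\<nu> / \<rho>) *\<^sub>R (chi *\<^sub>R (v0 - v) + \<omega> *\<^sub>R (vh - v)))
        else None)"

text \<open>
  \<open>iterate A B L \<gamma> \<mu> lam z0 n\<close> is the pair \<open>(x\<^sub>n, v\<^sub>n)\<close>, or \<open>None\<close> if the algorithm got stuck before
  producing it.
\<close>

primrec iterate ::
  "('h::real_inner \<Rightarrow> 'h set) \<Rightarrow> ('g::real_inner \<Rightarrow> 'g set) \<Rightarrow> ('h \<Rightarrow> 'g) \<Rightarrow>
   (nat \<Rightarrow> real) \<Rightarrow> (nat \<Rightarrow> real) \<Rightarrow> (nat \<Rightarrow> real) \<Rightarrow> 'h \<times> 'g \<Rightarrow> nat \<Rightarrow> ('h \<times> 'g) option" where
  "iterate A B L \<gamma> \<mu> lam z0 0 = Some z0"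
| "iterate A B L \<gamma> \<mu> lam z0 (Suc n) =
     Option.bind (iterate A B L \<gamma> \<mu> lam z0 n)
       (\<lambda>z. anchored_update z0 z (half_step A B L (\<gamma> n) (\<mu> n) (lam n) z))"

end

theory Submission
  imports Defs
begin

text \<open>
  Each half-step is a relaxed projection onto a half-space containing the Kuhn--Tucker set \<open>Z\<close>, and
  each update projects the anchor \<open>z0 = (x0, v0)\<close> onto the intersection of two half-spaces that
  contain \<open>Z\<close>. Hence \<open>\<parallel>z0 - z\<^sub>n\<parallel>\<close> increases and stays below the distance from \<open>z0\<close> to \<open>Z\<close>; the
  Pythagorean inequality makes the squared increments summable, and they dominate all the
  residuals. Since \<open>Z\<close> is an intersection of half-spaces, one for each pair of points of the graphs
  of \<open>A\<close> and \<open>B\<close>, and vanishing residuals make each half-space inequality hold in the limit, \<open>z\<^sub>n\<close>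
  cannot stay away from the projection of \<open>z0\<close> onto \<open>Z\<close>.
\<close>

section \<open>Minimizing a quadratic function over a closed convex set\<close>

text \<open>In infinite dimension a bounded sequence need not have a convergent subsequence, and the
  operators are set-valued without any continuity, so membership in \<open>Z\<close> cannot be
  passed to a limit directly. The way out is a cancellation: the monotonicity products of
  \<open>A\<close> at \<open>(x, - adjoint L v)\<close> and of \<open>B\<close> at
  \<open>(L x, v)\<close> each contain a term bilinear in \<open>(x, v)\<close>, and these terms
  cancel in the sum. The sum is affine in \<open>(x, v)\<close>, so it can be tested on closed
  convex hulls.

  The residuals are controlled through the numerator of \<open>theta\<close> without its relaxation
  factor. This number \<sigma> is the amount by which the iterate violates a half-space containing
  \<open>Z\<close>, and the squared norm \<open>tau\<close> of the normal is at most a constant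
  \<open>C\<close> times \<sigma>. For positive \<open>tau\<close> the half-step has squared length
  \<open>lam\<^sup>2 * \<sigma>\<^sup>2 / tau\<close>, which is at least
  \<open>\<epsilon>\<^sup>2 * \<sigma> / C\<close>. Summability of the squared half-steps thus gives
  summability of \<sigma>, and every residual is bounded by a multiple of \<sigma>.\<close>

lemma nonneg_of_linear_plus_quadratic:
  fixes a b :: real
  assumes "\<And>t. 0 < t \<Longrightarrow> t \<le> 1 \<Longrightarrow> 0 \<le> t * a + t\<^sup>2 * b"
  shows "0 \<le> a"
proof (rule tendsto_lowerbound)
  show "((\<lambda>t. a + t * b) \<longlongrightarrow> a) (at_right 0)"
    by (auto intro!: tendsto_eq_intros)
  show "\<forall>\<^sub>F t in at_right 0. 0 \<le> a + t * b"
  proof (rule eventually_at_rightI)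
    fix t :: real
    assume t: "t \<in> {0<..<1}"
    then have "0 \<le> t * (a + t * b)"
      using assms[of t] by (simp add: algebra_simps power2_eq_square)
    with t show "0 \<le> a + t * b"
      by (simp add: zero_le_mult_iff)
  qed simp
qed simp

text \<open>
  Taking an epigraph as \<open>C\<close>, this minimizes a convex function plus \<open>\<parallel>w\<parallel>\<^sup>2 / 2\<close>. Projections,
  Riesz representation and Minty's theorem all reduce to it.
\<close>

lemma quadratic_minimizer:
  fixes C :: "('a::{real_inner, complete_space} \<times> real) set"
  assumes "closed C" and "convex C" and "C \<noteq> {}"
    and lb: "\<And>w r. (w, r) \<in> C \<Longrightarrow> m \<le> r + (norm w)\<^sup>2 / 2"
  obtains w r where "(w, r) \<in> C" "\<And>w' r'. (w', r') \<in> C \<Longrightarrow> r + w \<bullet> w \<le> r' + w \<bullet> w'"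
proof -
  define g where "g = (\<lambda>(w::'a, r). r + (norm w)\<^sup>2 / 2)"
  define I where "I = Inf (g ` C)"
  have bdd: "bdd_below (g ` C)"
    by (rule bdd_belowI2[of _ m]) (auto simp: g_def intro: lb)
  have I_le: "I \<le> g p" if "p \<in> C" for p
    unfolding I_def by (rule cInf_lower) (use bdd that in auto)
  have "\<exists>p\<in>C. g p < I + 1 / real (Suc n)" for n
    using cInf_lessD[of "g ` C" "I + 1 / real (Suc n)"] \<open>C \<noteq> {}\<close> by (auto simp: I_def)
  then obtain p where p: "\<And>n. p n \<in> C" and gp: "\<And>n. g (p n) < I + 1 / real (Suc n)"
    by metis
  define w where "w = (\<lambda>n. fst (p n))"
  define r where "r = (\<lambda>n. snd (p n))"
  \<comment> \<open>Parallelogram identity: \<open>g\<close> at the midpoint lies below the mean of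
    its values by an eighth of the squared distance of the \<open>w\<close> parts, yet not below the
    infimum.\<close>
  have near: "(norm (w i - w j))\<^sup>2 \<le> 4 * (1 / real (Suc i) + 1 / real (Suc j))" for i j
  proof -
    have "(1/2) *\<^sub>R p i + (1/2) *\<^sub>R p j \<in> C"
      using \<open>convex C\<close> p by (intro convexD) auto
    then have "I \<le> g ((1/2) *\<^sub>R p i + (1/2) *\<^sub>R p j)"
      by (rule I_le)
    also have "\<dots> = g (p i) / 2 + g (p j) / 2 - (norm (w i - w j))\<^sup>2 / 8"
      by (simp add: g_def w_def case_prod_beta power2_norm_eq_inner algebra_simps inner_simps
          inner_commute) (simp add: field_simps)
    finally show ?thesis
      using gp[of i] gp[of j] by simp
  qed
  have "Cauchy w"
  proof (rule CauchyI)
    fix e :: real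
    assume "0 < e"
    then obtain N where N: "1 / real (Suc N) < e\<^sup>2 / 8"
      using nat_approx_posE[of "e\<^sup>2 / 8"] by auto
    have "norm (w i - w j) < e" if "N \<le> i" "N \<le> j" for i j
    proof -
      have "1 / real (Suc i) \<le> 1 / real (Suc N)" "1 / real (Suc j) \<le> 1 / real (Suc N)"
        using that by (auto simp: field_simps)
      then have "(norm (w i - w j))\<^sup>2 < e\<^sup>2"
        using near[of i j] N by simp
      then show ?thesis
        using \<open>0 < e\<close> by (simp add: power2_less_imp_less)
    qed
    then show "\<exists>M. \<forall>i\<ge>M. \<forall>j\<ge>M. norm (w i - w j) < e"
      by blast
  qed
  then obtain w' where w': "w \<longlonglongrightarrow> w'"
    using Cauchy_convergent convergent_def by blast
  have upper: "(\<lambda>n. I + 1 / real (Suc n)) \<longlonglongrightarrow> I"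
    using tendsto_add[OF tendsto_const LIMSEQ_Suc[OF lim_1_over_n], of I] by simp
  have glim: "(\<lambda>n. g (p n)) \<longlonglongrightarrow> I"
  proof (rule tendsto_sandwich[OF _ _ tendsto_const upper])
    show "\<forall>\<^sub>F n in sequentially. I \<le> g (p n)"
      using I_le[OF p] by simp
    show "\<forall>\<^sub>F n in sequentially. g (p n) \<le> I + 1 / real (Suc n)"
      using less_imp_le[OF gp] by simp
  qed
  \<comment> \<open>The heights \<open>r n\<close> converge only because both \<open>g (p n)\<close>
    and \<open>norm (w n)\<close> do; this is the limit they must have.\<close>
  define r' where "r' = I - (norm w')\<^sup>2 / 2"
  have "r = (\<lambda>n. g (p n) - (norm (w n))\<^sup>2 / 2)"
    by (simp add: fun_eq_iff g_def w_def r_def case_prod_beta)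
  then have "r \<longlonglongrightarrow> r'"
    unfolding r'_def using glim w' by (auto intro!: tendsto_intros)
  with w' have "(\<lambda>n. (w n, r n)) \<longlonglongrightarrow> (w', r')"
    by (rule tendsto_Pair)
  then have mem: "(w', r') \<in> C"
    by (rule closed_sequentially[OF \<open>closed C\<close>, rotated]) (simp add: w_def r_def p)
  moreover have "r' + w' \<bullet> w' \<le> s + w' \<bullet> y" if "(y, s) \<in> C" for y s
  proof -
    define d where "d = y - w'"
    \<comment> \<open>First variation: moving from the minimizer towards \<open>(y, s)\<close> by a
      fraction \<open>t\<close> cannot decrease \<open>g\<close>, and the term linear in
      \<open>t\<close> dominates as \<open>t\<close> tends to 0.\<close>
    have "0 \<le> (s - r') + w' \<bullet> d"
    proof (rule nonneg_of_linear_plus_quadratic)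
      fix t :: real
      assume t: "0 < t" "t \<le> 1"
      have "(1 - t) *\<^sub>R (w', r') + t *\<^sub>R (y, s) \<in> C"
        using \<open>convex C\<close> mem that t by (intro convexD) auto
      moreover have "(1 - t) *\<^sub>R (w', r') + t *\<^sub>R (y, s) = (w' + t *\<^sub>R d, r' + t * (s - r'))"
        by (simp add: d_def algebra_simps)
      ultimately have "I \<le> g (w' + t *\<^sub>R d, r' + t * (s - r'))"
        using I_le by metis
      also have "\<dots> = I + (t * ((s - r') + w' \<bullet> d) + t\<^sup>2 * (d \<bullet> d / 2))"
        by (simp add: g_def r'_def power2_norm_eq_inner inner_add_left inner_add_right
            inner_commute[of d w'] power2_eq_square[of t] distrib_left add_divide_distrib)
      finally show "0 \<le> t * ((s - r') + w' \<bullet> d) + t\<^sup>2 * (d \<bullet> d / 2)"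
        by simp
    qed
    then show ?thesis
      by (simp add: d_def inner_diff_right)
  qed
  ultimately show thesis
    using that by blast
qed

text \<open>For the translate of \<open>S\<close> by \<open>- z\<close>, placed at height 0, the
  variational inequality reads \<open>w \<bullet> w \<le> w \<bullet> w'\<close>, which is the
  obtuse-angle condition at \<open>w + z\<close>.\<close>

lemma projection_exists:
  fixes S :: "'a::{real_inner, complete_space} set"
  assumes "closed S" "convex S" "S \<noteq> {}"
  obtains p where "p \<in> S" "\<And>q. q \<in> S \<Longrightarrow> (q - p) \<bullet> (z - p) \<le> 0"
proof -
  define C where "C = {(w, r::real). w + z \<in> S \<and> r = 0}"
  have eq: "C = ((\<lambda>w. w - z) ` S) \<times> {0}"
    by (force simp: C_def)
  obtain w r where "(w, r) \<in> C" and var: "\<And>w' r'. (w', r') \<in> C \<Longrightarrow> r + w \<bullet> w \<le> r' + w \<bullet> w'"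
  proof (rule quadratic_minimizer)
    show "closed C"
      unfolding eq using closed_translation_subtract[OF \<open>closed S\<close>] by (intro closed_Times) auto
    show "convex C"
      unfolding eq using \<open>convex S\<close> by (intro convex_Times) auto
    show "C \<noteq> {}"
      using \<open>S \<noteq> {}\<close> by (simp add: eq)
    show "0 \<le> r + (norm w)\<^sup>2 / 2" if "(w, r) \<in> C" for w r
      using that by (simp add: C_def)
  qed blast
  show thesis
  proof
    show "w + z \<in> S"
      using \<open>(w, r) \<in> C\<close> by (simp add: C_def)
    show "(q - (w + z)) \<bullet> (z - (w + z)) \<le> 0" if "q \<in> S" for q
      using var[of "q - z" 0] \<open>(w, r) \<in> C\<close> that
      by (simp add: C_def inner_simps inner_commute algebra_simps)
  qed
qed

text \<open>\<open>projection\<close> is a definite description, so a unique nearest point is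
  required. The obtuse angle gives a Pythagorean inequality, which yields minimality and uniqueness
  together.\<close>

lemma projection_properties:
  fixes S :: "'a::{real_inner, complete_space} set"
  assumes "closed S" "convex S" "S \<noteq> {}"
  shows "projection S z \<in> S"
    and "\<And>q. q \<in> S \<Longrightarrow> (q - projection S z) \<bullet> (z - projection S z) \<le> 0"
proof -
  obtain p where p: "p \<in> S" "\<And>q. q \<in> S \<Longrightarrow> (q - p) \<bullet> (z - p) \<le> 0"
    using projection_exists[OF assms] by blast
  have pyth: "(dist z p)\<^sup>2 + (dist p q)\<^sup>2 \<le> (dist z q)\<^sup>2" if "q \<in> S" for q
    using p(2)[OF that]
    by (simp add: dist_norm power2_norm_eq_inner inner_simps inner_commute algebra_simps)
  have "projection S z = p"
    unfolding projection_def
  proof (rule the_equality)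
    have "dist z p \<le> dist z q" if "q \<in> S" for q
    proof (rule power2_le_imp_le)
      show "(dist z p)\<^sup>2 \<le> (dist z q)\<^sup>2"
        using pyth[OF that] zero_le_power2[of "dist p q"] by linarith
    qed simp
    then show "p \<in> S \<and> (\<forall>q\<in>S. dist z p \<le> dist z q)"
      using p by blast
  next
    fix q
    assume q: "q \<in> S \<and> (\<forall>q'\<in>S. dist z q \<le> dist z q')"
    then have "(dist z q)\<^sup>2 \<le> (dist z p)\<^sup>2"
      using p by (intro power_mono) auto
    then have "(dist p q)\<^sup>2 \<le> 0"
      using pyth[of q] q by linarith
    then show "q = p"
      by simp
  qed
  with p show "projection S z \<in> S"
    and "\<And>q. q \<in> S \<Longrightarrow> (q - projection S z) \<bullet> (z - projection S z) \<le> 0"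
    by auto
qed

text \<open>The representing vector is the minimizer of \<open>norm w ^ 2 / 2 - f w\<close>, so
  \<open>C\<close> is the epigraph of \<open>- f\<close>.\<close>

lemma riesz_representation:
  fixes f :: "'a::{real_inner, complete_space} \<Rightarrow> real"
  assumes "bounded_linear f"
  obtains w where "\<And>x. f x = w \<bullet> x"
proof -
  interpret f: bounded_linear f by fact
  define C where "C = {(w, r). - f w \<le> r}"
  obtain K where K: "\<And>x. norm (f x) \<le> norm x * K"
    using f.bounded by blast
  obtain w r where mem: "(w, r) \<in> C"
    and var: "\<And>w' r'. (w', r') \<in> C \<Longrightarrow> r + w \<bullet> w \<le> r' + w \<bullet> w'"
  proof (rule quadratic_minimizer)
    show "closed C"
      unfolding C_def case_prod_beta
      by (intro closed_Collect_le continuous_intros f.continuous_on)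
    show "convex C"
    proof (rule convexI)
      fix p q :: "'a \<times> real" and t s :: real
      assume pq: "p \<in> C" "q \<in> C" and ts: "0 \<le> t" "0 \<le> s" "t + s = 1"
      have "t * - f (fst p) + s * - f (fst q) \<le> t * snd p + s * snd q"
        using pq ts by (intro add_mono mult_left_mono) (auto simp: C_def)
      then show "t *\<^sub>R p + s *\<^sub>R q \<in> C"
        by (simp add: C_def case_prod_beta f.add f.scaleR)
    qed
    have "(0, 0) \<in> C"
      by (simp add: C_def f.zero)
    then show "C \<noteq> {}"
      by blast
    show "- K\<^sup>2 / 2 \<le> r + (norm w)\<^sup>2 / 2" if "(w, r) \<in> C" for w r
    proof -
      have "- (norm w * K) \<le> r"
        using that K[of w] by (simp add: C_def)
      \<comment> \<open>Completing the square; this is the origin of the lower bound in terms of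
        \<open>K\<close>.\<close>
      moreover have "0 \<le> (norm w - K)\<^sup>2"
        by simp
      ultimately show ?thesis
        by (simp add: power2_diff)
    qed
  qed blast
  have le: "f x \<le> w \<bullet> x" for x
  proof -
    have "r + w \<bullet> w \<le> - f (w + x) + w \<bullet> (w + x)"
      by (rule var) (simp add: C_def)
    then show ?thesis
      using mem by (simp add: C_def f.add inner_add_right)
  qed
  show thesis
  proof
    show "f x = w \<bullet> x" for x
      using le[of x] le[of "- x"] by (simp add: linear_neg f.linear)
  qed
qed

text \<open>\<open>adjoint L\<close> is chosen among all maps satisfying this identity, so the
  identity holds once some such map exists; Riesz representation supplies one.\<close>

lemma adjoint_inner:
  fixes L :: "'h::{real_inner, complete_space} \<Rightarrow> 'g::real_inner"
  assumes "bounded_linear L"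
  shows "x \<bullet> adjoint L y = L x \<bullet> y"
proof -
  have "\<exists>w. \<forall>x. L x \<bullet> y = x \<bullet> w" for y
  proof -
    have "bounded_linear (\<lambda>x. L x \<bullet> y)"
      using bounded_linear_compose[OF bounded_linear_inner_left assms] by simp
    then obtain w where "\<And>x. L x \<bullet> y = w \<bullet> x"
      using riesz_representation by blast
    then show ?thesis
      by (metis inner_commute)
  qed
  then obtain L' where "\<forall>x y. L x \<bullet> y = x \<bullet> L' y"
    by metis
  then have "\<forall>x y. L x \<bullet> y = x \<bullet> adjoint L y"
    unfolding adjoint_def by (rule someI[where P = "\<lambda>f. \<forall>x y. L x \<bullet> y = x \<bullet> f y"])
  then show ?thesis
    by simp
qed

lemma norm_adjoint_le:
  fixes L :: "'h::{real_inner, complete_space} \<Rightarrow> 'g::real_inner"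
  assumes "bounded_linear L" and "\<And>x. norm (L x) \<le> K * norm x" and "0 \<le> K"
  shows "norm (adjoint L y) \<le> K * norm y"
proof (cases "adjoint L y = 0")
  case True
  then show ?thesis
    using \<open>0 \<le> K\<close> by simp
next
  case False
  have "norm (adjoint L y) * norm (adjoint L y) = L (adjoint L y) \<bullet> y"
    using adjoint_inner[OF assms(1), of "adjoint L y" y]
    by (simp add: power2_norm_eq_inner flip: power2_eq_square)
  also have "\<dots> \<le> norm (L (adjoint L y)) * norm y"
    by (rule norm_cauchy_schwarz)
  also have "\<dots> \<le> K * norm (adjoint L y) * norm y"
    by (intro mult_right_mono assms) simp
  finally show ?thesis
    using False by (simp add: mult.commute mult.left_commute)
qed

section \<open>Minty's theorem\<close>

lemma maximally_monotoneD:
  assumes "maximally_monotone A" "u \<in> A x" "v \<in> A y"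
  shows "0 \<le> (x - y) \<bullet> (u - v)"
  using assms by (force simp: maximally_monotone_def monotone_op_def gra_def)

text \<open>Otherwise \<open>(x, u)\<close> could be adjoined to the graph without losing
  monotonicity. This is the only form in which maximality is used.\<close>

lemma maximally_monotone_mem:
  fixes A :: "'a::real_inner \<Rightarrow> 'a set"
  assumes A: "maximally_monotone A"
    and rel: "\<And>y v. v \<in> A y \<Longrightarrow> 0 \<le> (x - y) \<bullet> (u - v)"
  shows "u \<in> A x"
proof (rule ccontr)
  assume "u \<notin> A x"
  define A' where "A' = A(x := insert u (A x))"
  have gra: "gra A' = insert (x, u) (gra A)"
    by (auto simp: A'_def gra_def split: if_splits)
  have rel': "0 \<le> (y - x) \<bullet> (v - u)" if "v \<in> A y" for y v
    using rel[OF that] by (simp add: inner_simps)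
  have "monotone_op A'"
    unfolding monotone_op_def gra
    using rel rel' maximally_monotoneD[OF A] by (auto simp: gra_def)
  moreover have "gra A \<subset> gra A'"
    using \<open>u \<notin> A x\<close> unfolding gra by (auto simp: gra_def)
  ultimately show False
    using A by (auto simp: maximally_monotone_def)
qed

text \<open>
  \<open>C\<close> is the epigraph of the Fitzpatrick function of the graph \<open>G\<close>. A minimizer \<open>(x, u)\<close> of that
  function plus \<open>\<parallel>(x, u)\<parallel>\<^sup>2 / 2\<close> makes \<open>(- u, - x)\<close> monotonically related to \<open>G\<close>, and then
  \<open>u = - x\<close>.
\<close>

lemma minty_graph:
  fixes G :: "('a::{real_inner, complete_space} \<times> 'a) set"
  assumes mono: "\<And>x u y v. (x, u) \<in> G \<Longrightarrow> (y, v) \<in> G \<Longrightarrow> 0 \<le> (x - y) \<bullet> (u - v)"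
    and max: "\<And>x u. (\<And>y v. (y, v) \<in> G \<Longrightarrow> 0 \<le> (x - y) \<bullet> (u - v)) \<Longrightarrow> (x, u) \<in> G"
  obtains x where "(x, - x) \<in> G"
proof -
  define C where "C = (\<Inter>(y, v)\<in>G. {((x, u), r). x \<bullet> v + y \<bullet> u - y \<bullet> v \<le> r})"
  have C_iff: "((x, u), r) \<in> C \<longleftrightarrow> (\<forall>(y, v)\<in>G. x \<bullet> v + y \<bullet> u - y \<bullet> v \<le> r)" for x u r
    by (auto simp: C_def)
  have graph: "((y, v), y \<bullet> v) \<in> C" if "(y, v) \<in> G" for y v
    using mono[OF that] by (fastforce simp: C_iff inner_simps)
  \<comment> \<open>The Fitzpatrick function dominates the duality product: on \<open>G\<close> by
    testing with the point itself, off \<open>G\<close> because maximality provides a graph point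
    that is not monotonically related.\<close>
  have above: "x \<bullet> u \<le> r" if "((x, u), r) \<in> C" for x u r
  proof (cases "(x, u) \<in> G")
    case True
    then show ?thesis
      using that by (auto simp: C_iff)
  next
    case False
    then obtain y v where "(y, v) \<in> G" "(x - y) \<bullet> (u - v) < 0"
      using max[of x u] by (force simp: not_le)
    moreover have "x \<bullet> v + y \<bullet> u - y \<bullet> v \<le> r"
      using that \<open>(y, v) \<in> G\<close> by (auto simp: C_iff)
    ultimately show ?thesis
      by (simp add: inner_simps)
  qed
  obtain w r where mem: "(w, r) \<in> C"
    and var: "\<And>w' r'. (w', r') \<in> C \<Longrightarrow> r + w \<bullet> w \<le> r' + w \<bullet> w'"
  proof (rule quadratic_minimizer)
    show "closed C"
      unfolding C_def case_prod_beta
      by (intro closed_INT ballI closed_Collect_le continuous_intros)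
    show "convex C"
      unfolding C_def
    proof (intro convex_INT, clarify)
      fix y v :: 'a
      show "convex {((x, u), r). x \<bullet> v + y \<bullet> u - y \<bullet> v \<le> r}"
      proof (rule convexI)
        fix p q :: "('a \<times> 'a) \<times> real" and s t :: real
        assume p: "p \<in> {((x, u), r). x \<bullet> v + y \<bullet> u - y \<bullet> v \<le> r}"
          and q: "q \<in> {((x, u), r). x \<bullet> v + y \<bullet> u - y \<bullet> v \<le> r}"
          and st: "0 \<le> s" "0 \<le> t" "s + t = 1"
        obtain x u r x' u' r' where eq: "p = ((x, u), r)" "q = ((x', u'), r')"
          by (metis prod.exhaust)
        have "s * (x \<bullet> v + y \<bullet> u - y \<bullet> v) + t * (x' \<bullet> v + y \<bullet> u' - y \<bullet> v) \<le> s * r + t * r'"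
          using p q st by (intro add_mono mult_left_mono) (auto simp: eq)
        moreover have "s * (y \<bullet> v) + t * (y \<bullet> v) = y \<bullet> v"
          using st(3) by (simp flip: distrib_right)
        ultimately show "s *\<^sub>R p + t *\<^sub>R q \<in> {((x, u), r). x \<bullet> v + y \<bullet> u - y \<bullet> v \<le> r}"
          by (simp add: eq inner_simps algebra_simps)
      qed
    qed
    \<comment> \<open>An empty \<open>G\<close> would satisfy the premise of \<open>max\<close>
      vacuously for every pair.\<close>
    obtain y v where "(y, v) \<in> G"
      using max by blast
    then show "C \<noteq> {}"
      using graph by blast
    show "0 \<le> r + (norm w)\<^sup>2 / 2" if "(w, r) \<in> C" for w r
    proof -
      obtain x u where w: "w = (x, u)"
        by (metis prod.exhaust)
      have "0 \<le> (x + u) \<bullet> (x + u)"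
        by simp
      also have "\<dots> = 2 * (x \<bullet> u) + (norm w)\<^sup>2"
        by (simp add: w power2_norm_eq_inner inner_simps inner_commute)
      finally show ?thesis
        using above[of x u r] that by (simp add: w)
    qed
  qed blast
  obtain x u where w: "w = (x, u)"
    by (metis prod.exhaust)
  \<comment> \<open>The graph point \<open>((y, v), y \<bullet> v)\<close> of the epigraph is
    inserted in the variational inequality, and \<open>r\<close> is bounded below by
    \<open>x \<bullet> u\<close>; adding \<open>x \<bullet> u\<close> to both sides gives the two
    products.\<close>
  have key: "(x + u) \<bullet> (x + u) \<le> (- u - y) \<bullet> (- x - v)" if "(y, v) \<in> G" for y v
    using var[OF graph[OF that]] above[of x u r] mem
    by (simp add: w inner_simps inner_commute algebra_simps)
  have "(- u, - x) \<in> G"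
    by (rule max) (use key inner_ge_zero order_trans in blast)
  moreover have "x = - u"
  proof -
    \<comment> \<open>For \<open>(y, v) = (- u, - x)\<close> the right-hand side of
      \<open>key\<close> vanishes.\<close>
    have "\<not> 0 < (x + u) \<bullet> (x + u)"
      using key[OF \<open>(- u, - x) \<in> G\<close>] by (simp del: inner_gt_zero_iff)
    then have "x + u = 0"
      unfolding inner_gt_zero_iff by simp
    then show ?thesis
      by (simp only: eq_neg_iff_add_eq_0)
  qed
  ultimately show thesis
    using that by blast
qed

text \<open>\<open>G\<close> is the graph of \<open>A\<close> scaled by \<gamma> and shifted by
  \<open>- z\<close>, which is again maximal monotone; a point \<open>(x, - x)\<close> of it solves
  the equation.\<close>

lemma minty:
  fixes A :: "'a::{real_inner, complete_space} \<Rightarrow> 'a set"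
  assumes A: "maximally_monotone A" and "0 < \<gamma>"
  obtains x u where "u \<in> A x" "x + \<gamma> *\<^sub>R u = z"
proof -
  define G where "G = {(x, \<gamma> *\<^sub>R u - z) | x u. u \<in> A x}"
  obtain x where "(x, - x) \<in> G"
  proof (rule minty_graph)
    fix x u y v
    assume "(x, u) \<in> G" "(y, v) \<in> G"
    then obtain u' v' where "u = \<gamma> *\<^sub>R u' - z" "u' \<in> A x" "v = \<gamma> *\<^sub>R v' - z" "v' \<in> A y"
      by (auto simp: G_def)
    moreover from this have "0 \<le> \<gamma> * ((x - y) \<bullet> (u' - v'))"
      using maximally_monotoneD[OF A] \<open>0 < \<gamma>\<close> by simp
    ultimately show "0 \<le> (x - y) \<bullet> (u - v)"
      by (simp flip: scaleR_diff_right)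
  next
    fix x u
    assume rel: "\<And>y v. (y, v) \<in> G \<Longrightarrow> 0 \<le> (x - y) \<bullet> (u - v)"
    have "(1 / \<gamma>) *\<^sub>R (u + z) \<in> A x"
    proof (rule maximally_monotone_mem[OF A])
      fix y v
      assume "v \<in> A y"
      then have "0 \<le> (x - y) \<bullet> (u - (\<gamma> *\<^sub>R v - z))"
        by (intro rel) (auto simp: G_def)
      also have "u - (\<gamma> *\<^sub>R v - z) = \<gamma> *\<^sub>R ((1 / \<gamma>) *\<^sub>R (u + z) - v)"
        using \<open>0 < \<gamma>\<close> by (simp add: algebra_simps)
      finally show "0 \<le> (x - y) \<bullet> ((1 / \<gamma>) *\<^sub>R (u + z) - v)"
        using \<open>0 < \<gamma>\<close> by (simp only: inner_scaleR_right zero_le_mult_iff) auto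
    qed
    moreover have "u = \<gamma> *\<^sub>R ((1 / \<gamma>) *\<^sub>R (u + z)) - z"
      using \<open>0 < \<gamma>\<close> by simp
    ultimately show "(x, u) \<in> G"
      unfolding G_def by blast
  qed
  then obtain u where "u \<in> A x" "- x = \<gamma> *\<^sub>R u - z"
    by (auto simp: G_def)
  then show thesis
    using that[of u x] by (simp add: algebra_simps eq_diff_eq)
qed

text \<open>\<open>the_elem\<close> is meaningful only on a singleton. Existence is Minty's theorem;
  uniqueness holds because two solutions satisfy
  \<open>y - x = - (\<gamma> *\<^sub>R (v - u))\<close>, whereas monotonicity makes
  \<open>(y - x) \<bullet> (v - u)\<close> nonnegative.\<close>

lemma resolvent_fun_mem:
  fixes A :: "'a::{real_inner, complete_space} \<Rightarrow> 'a set"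
  assumes A: "maximally_monotone A" and "0 < \<gamma>"
  shows "inverse \<gamma> *\<^sub>R (z - resolvent_fun (op_scale \<gamma> A) z) \<in> A (resolvent_fun (op_scale \<gamma> A) z)"
proof -
  have res: "resolvent (op_scale \<gamma> A) z = {x. \<exists>u\<in>A x. x + \<gamma> *\<^sub>R u = z}"
    by (auto simp: resolvent_def op_inverse_def op_scale_def set_plus_def)
  obtain x u where xu: "u \<in> A x" "x + \<gamma> *\<^sub>R u = z"
    using minty[OF assms] by blast
  have unique: "y = x" if "v \<in> A y" "y + \<gamma> *\<^sub>R v = z" for y v
  proof -
    have "y - x = - (\<gamma> *\<^sub>R (v - u))"
      using xu(2) that(2) by (auto simp: algebra_simps)
    moreover have "0 \<le> \<gamma> * ((y - x) \<bullet> (v - u))"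
      using maximally_monotoneD[OF A that(1) xu(1)] \<open>0 < \<gamma>\<close> by simp
    ultimately have "\<not> 0 < (y - x) \<bullet> (y - x)"
      by (metis inner_minus_right inner_scaleR_right neg_le_0_iff_le not_less)
    then show ?thesis
      unfolding inner_gt_zero_iff by simp
  qed
  have "resolvent (op_scale \<gamma> A) z = {x}"
    unfolding res using xu unique by blast
  moreover have "inverse \<gamma> *\<^sub>R (z - x) = u"
    unfolding xu(2)[symmetric] using \<open>0 < \<gamma>\<close> by simp
  ultimately show ?thesis
    using xu(1) by (simp add: resolvent_fun_def)
qed

section \<open>Asymptotic membership in an intersection of convex sets\<close>

text \<open>The points of least norm take over the role of weak compactness. Their norms increase
  and stay bounded, and the obtuse-angle condition turns convergence of the squared norms into the
  Cauchy property of the points.\<close>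

lemma nested_closed_convex_Inter:
  fixes C :: "nat \<Rightarrow> 'a::{real_inner, complete_space} set"
  assumes closed: "\<And>n. closed (C n)" and convex: "\<And>n. convex (C n)" and ne: "\<And>n. C n \<noteq> {}"
    and nested: "\<And>m n. m \<le> n \<Longrightarrow> C n \<subseteq> C m"
    and bounded: "bounded (C 0)"
  obtains c where "\<And>n. c \<in> C n"
proof -
  have "\<exists>p. p \<in> C n \<and> (\<forall>q\<in>C n. (q - p) \<bullet> (0 - p) \<le> 0)" for n
    using projection_exists[OF closed convex ne, of n 0] by metis
  then obtain p where p: "\<And>n. p n \<in> C n"
    and var: "\<And>n q. q \<in> C n \<Longrightarrow> (q - p n) \<bullet> (0 - p n) \<le> 0"
    by metis
  have step: "(norm (p n - p m))\<^sup>2 \<le> (norm (p n))\<^sup>2 - (norm (p m))\<^sup>2" if "m \<le> n" for m n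
  proof -
    have "(p n - p m) \<bullet> (0 - p m) \<le> 0"
      using var p nested[OF that] by blast
    then show ?thesis
      by (simp add: power2_norm_eq_inner inner_simps inner_commute)
  qed
  obtain K where K: "\<And>x. x \<in> C 0 \<Longrightarrow> norm x \<le> K"
    using bounded by (auto simp: bounded_iff)
  define h where "h = (\<lambda>n. (norm (p n))\<^sup>2)"
  have "convergent h"
  proof (rule Bseq_mono_convergent)
    have "norm (h n) \<le> K\<^sup>2" for n
      unfolding h_def using K[of "p n"] p[of n] nested[of 0 n] by (auto intro!: power_mono)
    then show "Bseq h"
      by (rule BseqI')
    have "h m \<le> h n" if "m \<le> n" for m n
      using step[OF that] zero_le_power2[of "norm (p n - p m)"] unfolding h_def by linarith
    then show "\<forall>m. \<forall>n\<ge>m. h m \<le> h n"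
      by blast
  qed
  then have "Cauchy h"
    by (rule convergent_Cauchy)
  have "Cauchy p"
  proof (rule CauchyI')
    fix e :: real
    assume "0 < e"
    then obtain N where N: "\<And>m n. N \<le> m \<Longrightarrow> N \<le> n \<Longrightarrow> norm (h m - h n) < e\<^sup>2"
      using CauchyD[OF \<open>Cauchy h\<close>, of "e\<^sup>2"] by auto
    have "dist (p m) (p n) < e" if "N \<le> m" "m < n" for m n
    proof (rule power2_less_imp_less)
      show "(dist (p m) (p n))\<^sup>2 < e\<^sup>2"
        using step[of m n] N[of n m] that
        by (simp add: h_def dist_norm norm_minus_commute)
    qed (use \<open>0 < e\<close> in simp)
    then show "\<exists>M. \<forall>m\<ge>M. \<forall>n>m. dist (p m) (p n) < e"
      by blast
  qed
  then obtain c where c: "p \<longlonglongrightarrow> c"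
    using Cauchy_convergent convergent_def by blast
  show thesis
  proof
    fix n
    have "(\<lambda>k. p (k + n)) \<longlonglongrightarrow> c"
      using c by (rule LIMSEQ_ignore_initial_segment)
    then show "c \<in> C n"
      by (rule closed_sequentially[OF closed, rotated]) (use p nested le_add2 in blast)
  qed
qed

text \<open>
  This replaces the extraction of weakly convergent subsequences: a point common to the closed
  convex hulls of the tails that lie in \<open>D\<close> plays the part of a weak cluster point.
\<close>

lemma eventually_avoids:
  fixes z :: "nat \<Rightarrow> 'a::{real_inner, complete_space}"
  assumes "bounded (range z)"
    and sep: "\<And>w. w \<notin> Z \<Longrightarrow> \<exists>S. closed S \<and> convex S \<and> w \<notin> S \<and> (\<forall>\<^sub>F n in sequentially. z n \<in> S)"
    and D: "closed D" "convex D" "D \<inter> Z = {}"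
  shows "\<forall>\<^sub>F n in sequentially. z n \<notin> D"
proof (rule ccontr)
  assume "\<not> ?thesis"
  then have often: "\<exists>k\<ge>n. z k \<in> D" for n
    by (auto simp: eventually_sequentially)
  define T where "T = (\<lambda>n. {z k | k. n \<le> k \<and> z k \<in> D})"
  define C where "C = (\<lambda>n. closure (convex hull T n))"
  have C_sub: "C n \<subseteq> S" if "closed S" "convex S" "T n \<subseteq> S" for n S
    unfolding C_def using that by (intro closure_minimal hull_minimal)
  obtain c where c: "\<And>n. c \<in> C n"
  proof (rule nested_closed_convex_Inter)
    show "closed (C n)" "convex (C n)" for n
      by (simp_all add: C_def convex_closure)
    show "C n \<noteq> {}" for n
      using often[of n] by (auto simp: C_def T_def)
    show "C n \<subseteq> C m" if "m \<le> n" for m n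
      unfolding C_def using that by (intro closure_mono hull_mono) (auto simp: T_def)
    have "bounded (T 0)"
      using \<open>bounded (range z)\<close> by (rule bounded_subset) (auto simp: T_def)
    then show "bounded (C 0)"
      unfolding C_def by (intro bounded_closure bounded_convex_hull)
  qed blast
  have "c \<in> D"
    using c C_sub[OF D(1,2), of 0] by (auto simp: T_def)
  moreover have "c \<in> Z"
  proof (rule ccontr)
    assume "c \<notin> Z"
    \<comment> \<open>A closed convex set that contains the sequence from \<open>N\<close> on
      contains the closed convex hull \<open>C N\<close>, hence \<open>c\<close>.\<close>
    then obtain S N where S: "closed S" "convex S" "c \<notin> S" and N: "\<And>n. N \<le> n \<Longrightarrow> z n \<in> S"
      using sep by (metis eventually_sequentially)
    have "T N \<subseteq> S"
      using N by (auto simp: T_def)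
    then show False
      using c C_sub S by blast
  qed
  ultimately show False
    using D(3) by blast
qed

text \<open>Control in the single direction \<open>p - z0\<close> suffices for strong convergence:
  since \<open>z n\<close> is no farther from \<open>z0\<close> than \<open>p\<close> is, its
  squared distance to \<open>p\<close> is at most
  \<open>2 * ((p - z0) \<bullet> (p - z n))\<close>.\<close>

lemma tendsto_projection:
  fixes z :: "nat \<Rightarrow> 'a::{real_inner, complete_space}"
  assumes p: "p \<in> Z" "\<And>q. q \<in> Z \<Longrightarrow> (q - p) \<bullet> (z0 - p) \<le> 0"
    and le: "\<And>n. norm (z0 - z n) \<le> norm (z0 - p)"
    and sep: "\<And>w. w \<notin> Z \<Longrightarrow> \<exists>S. closed S \<and> convex S \<and> w \<notin> S \<and> (\<forall>\<^sub>F n in sequentially. z n \<in> S)"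
  shows "z \<longlonglongrightarrow> p"
proof (rule tendstoI)
  fix e :: real
  assume "0 < e"
  \<comment> \<open>The threshold \<open>e\<^sup>2 / 2\<close> matches that factor 2.
    \<open>D\<close> misses \<open>Z\<close> because \<open>p\<close> minimizes
    \<open>w \<mapsto> (p - z0) \<bullet> w\<close> over \<open>Z\<close>.\<close>
  define D where "D = {w. (p - z0) \<bullet> w \<le> (p - z0) \<bullet> p - e\<^sup>2 / 2}"
  have "\<forall>\<^sub>F n in sequentially. z n \<notin> D"
  proof (rule eventually_avoids)
    have "norm (z n) \<le> norm z0 + norm (z0 - p)" for n
      using le[of n] norm_triangle_ineq2[of "z n" z0] by (simp add: norm_minus_commute)
    then show "bounded (range z)"
      by (auto simp: bounded_iff)
    show "closed D" "convex D"
      unfolding D_def by (rule closed_halfspace_le convex_halfspace_le)+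
    show "D \<inter> Z = {}"
    proof (intro equals0I, elim IntE)
      fix w
      assume "w \<in> D" "w \<in> Z"
      then have "(p - z0) \<bullet> w \<le> (p - z0) \<bullet> p - e\<^sup>2 / 2" "(w - p) \<bullet> (z0 - p) \<le> 0"
        using p(2) by (simp_all add: D_def)
      moreover have "(w - p) \<bullet> (z0 - p) = (p - z0) \<bullet> p - (p - z0) \<bullet> w"
        by (simp add: inner_simps inner_commute)
      ultimately have "e\<^sup>2 \<le> 0"
        by linarith
      then show False
        using \<open>0 < e\<close> by simp
    qed
  qed (rule sep)
  then show "\<forall>\<^sub>F n in sequentially. dist (z n) p < e"
  proof (rule eventually_mono)
    fix n
    assume "z n \<notin> D"
    then have "(p - z0) \<bullet> p - e\<^sup>2 / 2 < (p - z0) \<bullet> z n"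
      by (simp add: D_def)
    moreover have "(norm (z0 - z n))\<^sup>2 \<le> (norm (z0 - p))\<^sup>2"
      using le by (intro power_mono) auto
    ultimately have "(dist (z n) p)\<^sup>2 < e\<^sup>2"
      by (simp add: dist_norm power2_norm_eq_inner inner_simps inner_commute)
    then show "dist (z n) p < e"
      using \<open>0 < e\<close> by (simp add: power2_less_imp_less)
  qed
qed

section \<open>The anchored update\<close>

lemma anchored_update_inner:
  "anchored_update z0 z y =
     (let chi = (z0 - z) \<bullet> (z - y);
          \<omega> = (norm (z0 - z))\<^sup>2;
          \<nu> = (norm (z - y))\<^sup>2;
          \<rho> = \<omega> * \<nu> - chi\<^sup>2
      in if \<rho> = 0 \<and> chi \<ge> 0 then Some y
         else if \<rho> > 0 \<and> chi * \<nu> \<ge> \<rho> then Some (z0 + (1 + chi / \<nu>) *\<^sub>R (y - z))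
         else if \<rho> > 0 \<and> chi * \<nu> < \<rho> then
           Some (z + (\<nu> / \<rho>) *\<^sub>R (chi *\<^sub>R (z0 - z) + \<omega> *\<^sub>R (y - z)))
         else None)"
  by (cases z0; cases z; cases y)
    (simp add: anchored_update_def Let_def power2_norm_eq_inner)

text \<open>
  \<open>Q\<close> is the projection of \<open>z0\<close> onto the intersection of the half-spaces
  \<open>{w. (w - z) \<bullet> (z0 - z) \<le> 0}\<close> and \<open>{w. (w - y) \<bullet> (z - y) \<le> 0}\<close>; that this intersection is
  nonempty excludes the outcome \<open>None\<close>.
\<close>

lemma anchored_update_Some:
  fixes z0 z y :: "'h::real_inner \<times> 'g::real_inner"
  assumes w0: "(w0 - z) \<bullet> (z0 - z) \<le> 0" "(w0 - y) \<bullet> (z - y) \<le> 0"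
  obtains Q where "anchored_update z0 z y = Some Q"
    and "(Q - z) \<bullet> (z0 - z) \<le> 0" and "(Q - y) \<bullet> (z - y) \<le> 0"
    and "\<And>w. (w - z) \<bullet> (z0 - z) \<le> 0 \<Longrightarrow> (w - y) \<bullet> (z - y) \<le> 0 \<Longrightarrow> (w - Q) \<bullet> (z0 - Q) \<le> 0"
proof -
  define a where "a = z0 - z"
  define b where "b = z - y"
  define chi where "chi = a \<bullet> b"
  define \<omega> where "\<omega> = a \<bullet> a"
  define \<nu> where "\<nu> = b \<bullet> b"
  define \<rho> where "\<rho> = \<omega> * \<nu> - chi\<^sup>2"
  have z0: "z0 = z + a" and y: "y = z - b"
    by (simp_all add: a_def b_def)
  have upd: "anchored_update z0 z y =
      (if \<rho> = 0 \<and> chi \<ge> 0 then Some y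
       else if \<rho> > 0 \<and> chi * \<nu> \<ge> \<rho> then Some (z + (a - (1 + chi / \<nu>) *\<^sub>R b))
       else if \<rho> > 0 \<and> chi * \<nu> < \<rho> then Some (z + (\<nu> / \<rho>) *\<^sub>R (chi *\<^sub>R a - \<omega> *\<^sub>R b))
       else None)"
    unfolding anchored_update_inner Let_def
    by (simp add: \<rho>_def \<omega>_def \<nu>_def chi_def z0 y power2_norm_eq_inner)
  have half1: "(w - z) \<bullet> (z0 - z) \<le> 0 \<longleftrightarrow> (w - z) \<bullet> a \<le> 0" for w
    by (simp add: a_def)
  have half2: "(w - y) \<bullet> (z - y) \<le> 0 \<longleftrightarrow> (w - z) \<bullet> b + \<nu> \<le> 0" for w
    by (simp add: y \<nu>_def inner_simps algebra_simps)
  note w0' = w0[unfolded half1 half2]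
  have "0 \<le> \<nu>" "0 \<le> \<omega>"
    by (simp_all add: \<nu>_def \<omega>_def)
  have "0 \<le> \<rho>"
    using Cauchy_Schwarz_ineq[of a b] by (simp add: \<rho>_def \<omega>_def \<nu>_def chi_def)
  have sym: "b \<bullet> a = chi" "a \<bullet> b = chi" "a \<bullet> a = \<omega>" "b \<bullet> b = \<nu>"
    by (simp_all add: chi_def \<omega>_def \<nu>_def inner_commute)
  show thesis
  proof (cases "\<rho> = 0")
    case True
    \<comment> \<open>Vanishing \<open>\<rho>\<close> is equality in the Cauchy-Schwarz
      inequality.\<close>
    have parallel: "\<nu> *\<^sub>R a = chi *\<^sub>R b"
    proof -
      have "(\<nu> *\<^sub>R a - chi *\<^sub>R b) \<bullet> (\<nu> *\<^sub>R a - chi *\<^sub>R b) = \<nu> * \<rho>"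
        by (simp add: inner_simps sym \<rho>_def power2_eq_square algebra_simps)
      with True show ?thesis
        by simp
    qed
    have par: "\<nu> * (w \<bullet> a) = chi * (w \<bullet> b)" for w
      using arg_cong[OF parallel, of "\<lambda>x. w \<bullet> x"] by simp
    \<comment> \<open>Parallel normals of opposite direction would make the two half-spaces
      disjoint, against \<open>w0\<close>.\<close>
    have "0 \<le> chi"
    proof (rule ccontr)
      assume "\<not> 0 \<le> chi"
      then have "0 < \<nu>"
        using \<open>0 \<le> \<nu>\<close> True by (auto simp: \<rho>_def less_le)
      have "chi * ((w0 - z) \<bullet> b) > 0"
        using \<open>\<not> 0 \<le> chi\<close> \<open>0 < \<nu>\<close> w0'(2) by (simp add: zero_less_mult_iff)
      moreover have "\<nu> * ((w0 - z) \<bullet> a) \<le> 0"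
        using \<open>0 < \<nu>\<close> w0'(1) by (simp add: mult_le_0_iff)
      ultimately show False
        using par[of "w0 - z"] by simp
    qed
    show thesis
    proof
      show "anchored_update z0 z y = Some y"
        using True \<open>0 \<le> chi\<close> by (simp add: upd)
      show "(y - z) \<bullet> (z0 - z) \<le> 0"
        unfolding half1 using \<open>0 \<le> chi\<close> by (simp add: y sym)
      show "(y - y) \<bullet> (z - y) \<le> 0"
        by simp
      fix w
      assume w: "(w - z) \<bullet> (z0 - z) \<le> 0" "(w - y) \<bullet> (z - y) \<le> 0"
      have "(w - y) \<bullet> a \<le> 0"
      proof (cases "\<nu> = 0")
        case True
        then have "y = z"
          by (simp add: \<nu>_def y)
        with w show ?thesis
          by (simp add: half1)
      next
        case False
        with \<open>0 \<le> \<nu>\<close> have "0 < \<nu>"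
          by simp
        have "chi * ((w - y) \<bullet> b) \<le> 0"
          using w(2) \<open>0 \<le> chi\<close> by (simp add: b_def mult_nonneg_nonpos)
        with par[of "w - y"] \<open>0 < \<nu>\<close> show ?thesis
          by (metis mult_le_0_iff not_less)
      qed
      moreover have "(w - y) \<bullet> b \<le> 0"
        using w(2) by (simp add: b_def)
      moreover have "z0 - y = a + b"
        by (simp add: a_def b_def)
      ultimately show "(w - y) \<bullet> (z0 - y) \<le> 0"
        by (simp add: inner_add_right)
    qed
  next
    case False
    with \<open>0 \<le> \<rho>\<close> have "0 < \<rho>"
      by simp
    then have "0 < \<nu>"
      using \<open>0 \<le> \<nu>\<close> by (cases "\<nu> = 0") (auto simp: \<rho>_def)
    show thesis
    proof (cases "\<rho> \<le> chi * \<nu>")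
      case True
      \<comment> \<open>Only the second half-space is active: \<open>z0 - Q\<close> is a nonnegative
        multiple of \<open>b\<close>, and \<open>\<rho> \<le> chi * \<nu>\<close> says exactly that
        \<open>Q\<close> also lies in the first.\<close>
      define Q where "Q = z + (a - (1 + chi / \<nu>) *\<^sub>R b)"
      have "0 < chi * \<nu>"
        using True \<open>0 < \<rho>\<close> by linarith
      then have "0 < chi"
        using \<open>0 < \<nu>\<close> by (simp add: zero_less_mult_iff)
      show thesis
      proof
        show "anchored_update z0 z y = Some Q"
          using True \<open>0 < \<rho>\<close> by (simp add: upd Q_def)
        have "\<nu> * ((Q - z) \<bullet> a) = \<rho> - chi * \<nu>"
          using \<open>0 < \<nu>\<close>
          by (simp add: Q_def inner_simps sym \<rho>_def field_simps power2_eq_square)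
        then have "\<nu> * ((Q - z) \<bullet> a) \<le> 0"
          using True by simp
        then show "(Q - z) \<bullet> (z0 - z) \<le> 0"
          unfolding half1 using \<open>0 < \<nu>\<close> by (simp add: mult_le_0_iff)
        show "(Q - y) \<bullet> (z - y) \<le> 0"
          unfolding half2 using \<open>0 < \<nu>\<close> by (simp add: Q_def inner_simps sym field_simps)
        fix w
        assume "(w - z) \<bullet> (z0 - z) \<le> 0" "(w - y) \<bullet> (z - y) \<le> 0"
        then have "(w - z) \<bullet> b + \<nu> \<le> 0"
          by (simp add: half2)
        moreover have "(w - Q) \<bullet> b = (w - z) \<bullet> b + \<nu>"
          using \<open>0 < \<nu>\<close> by (simp add: Q_def inner_simps sym field_simps)
        moreover have "z0 - Q = (1 + chi / \<nu>) *\<^sub>R b"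
          by (simp add: Q_def z0)
        moreover have "0 \<le> 1 + chi / \<nu>"
          using \<open>0 < chi\<close> \<open>0 < \<nu>\<close> by simp
        ultimately show "(w - Q) \<bullet> (z0 - Q) \<le> 0"
          by (simp add: mult_nonneg_nonpos)
      qed
    next
      case False
      \<comment> \<open>Both half-spaces are active: \<open>Q\<close> lies on the two bounding
        hyperplanes, and \<open>z0 - Q\<close> is a combination of \<open>a\<close> and
        \<open>b\<close> with nonnegative multipliers.\<close>
      define Q where "Q = z + (\<nu> / \<rho>) *\<^sub>R (chi *\<^sub>R a - \<omega> *\<^sub>R b)"
      have Qa: "(Q - z) \<bullet> a = 0"
        by (simp add: Q_def inner_simps sym)
      have "(Q - z) \<bullet> b = (\<nu> / \<rho>) * (- \<rho>)"
        by (simp add: Q_def inner_simps sym \<rho>_def power2_eq_square)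
      then have Qb: "(Q - z) \<bullet> b = - \<nu>"
        using \<open>0 < \<rho>\<close> by simp
      show thesis
      proof
        show "anchored_update z0 z y = Some Q"
          using False \<open>0 < \<rho>\<close> by (simp add: upd Q_def)
        show "(Q - z) \<bullet> (z0 - z) \<le> 0" "(Q - y) \<bullet> (z - y) \<le> 0"
          by (simp_all add: half1 half2 Qa Qb)
        fix w
        assume "(w - z) \<bullet> (z0 - z) \<le> 0" "(w - y) \<bullet> (z - y) \<le> 0"
        then have "(w - z) \<bullet> a \<le> 0" "(w - z) \<bullet> b + \<nu> \<le> 0"
          by (simp_all add: half1 half2)
        then have "(w - Q) \<bullet> a \<le> 0" "(w - Q) \<bullet> b \<le> 0"
          using Qa Qb by (simp_all add: inner_diff_left)
        moreover have "z0 - Q = (1 - \<nu> * chi / \<rho>) *\<^sub>R a + (\<nu> * \<omega> / \<rho>) *\<^sub>R b"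
          by (simp add: Q_def z0 algebra_simps)
        moreover have "0 \<le> 1 - \<nu> * chi / \<rho>" "0 \<le> \<nu> * \<omega> / \<rho>"
          using False \<open>0 < \<rho>\<close> \<open>0 < \<nu>\<close> \<open>0 \<le> \<omega>\<close> by (simp_all add: field_simps)
        ultimately show "(w - Q) \<bullet> (z0 - Q) \<le> 0"
          by (metis add_nonpos_nonpos inner_add_right inner_scaleR_right mult_nonneg_nonpos)
      qed
    qed
  qed
qed

text \<open>The invariant \<open>(w - z) \<bullet> (z0 - z) \<le> 0\<close> for \<open>w\<close> in
  \<open>Z\<close> places \<open>Z\<close> in the first half-space of the next update,
  \<open>cut\<close> places it in the second, and the projection property of the update returns the
  invariant. Any point of \<open>Z\<close> therefore rules out \<open>None\<close>.\<close>

lemma anchored_iteration: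
  fixes it :: "nat \<Rightarrow> ('h::real_inner \<times> 'g::real_inner) option"
  assumes it_0: "it 0 = Some z0"
    and it_Suc: "\<And>n. it (Suc n) = Option.bind (it n) (\<lambda>z. anchored_update z0 z (T n z))"
    and "Z \<noteq> {}"
    and cut: "\<And>n z w. it n = Some z \<Longrightarrow> w \<in> Z \<Longrightarrow> (w - T n z) \<bullet> (z - T n z) \<le> 0"
  obtains z where "\<And>n. it n = Some (z n)"
    and "\<And>n w. w \<in> Z \<Longrightarrow> norm (z0 - z n) \<le> norm (z0 - w)"
    and "summable (\<lambda>n. (norm (z (Suc n) - z n))\<^sup>2)"
    and "summable (\<lambda>n. (norm (z n - T n (z n)))\<^sup>2)"
proof -
  obtain w0 where "w0 \<in> Z"
    using \<open>Z \<noteq> {}\<close> by blast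
  have "\<exists>z. it n = Some z \<and> (\<forall>w\<in>Z. (w - z) \<bullet> (z0 - z) \<le> 0)" for n
  proof (induction n)
    case 0
    then show ?case
      by (simp add: it_0)
  next
    case (Suc n)
    then obtain z where z: "it n = Some z" "\<And>w. w \<in> Z \<Longrightarrow> (w - z) \<bullet> (z0 - z) \<le> 0"
      by blast
    obtain Q where "anchored_update z0 z (T n z) = Some Q"
      and "\<And>w. (w - z) \<bullet> (z0 - z) \<le> 0 \<Longrightarrow> (w - T n z) \<bullet> (z - T n z) \<le> 0 \<Longrightarrow> (w - Q) \<bullet> (z0 - Q) \<le> 0"
      using anchored_update_Some[of w0 z z0 "T n z"] z cut \<open>w0 \<in> Z\<close> by metis
    then show ?case
      using z cut by (simp add: it_Suc)
  qed
  then obtain z where it: "\<And>n. it n = Some (z n)"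
    and var: "\<And>n w. w \<in> Z \<Longrightarrow> (w - z n) \<bullet> (z0 - z n) \<le> 0"
    by metis
  have half1: "(z (Suc n) - z n) \<bullet> (z0 - z n) \<le> 0"
    and half2: "(z (Suc n) - T n (z n)) \<bullet> (z n - T n (z n)) \<le> 0" for n
  proof -
    have "anchored_update z0 (z n) (T n (z n)) = Some (z (Suc n))"
      using it_Suc[of n] by (simp add: it)
    then show "(z (Suc n) - z n) \<bullet> (z0 - z n) \<le> 0"
      and "(z (Suc n) - T n (z n)) \<bullet> (z n - T n (z n)) \<le> 0"
      using anchored_update_Some[of w0 "z n" z0 "T n (z n)"] var[OF \<open>w0 \<in> Z\<close>]
        cut[OF it \<open>w0 \<in> Z\<close>] by (metis option.inject)+
  qed
  have pyth: "(norm (c - b))\<^sup>2 + (norm (b - a))\<^sup>2 \<le> (norm (c - a))\<^sup>2"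
    if "(a - b) \<bullet> (c - b) \<le> 0" for a b c :: "'h \<times> 'g"
    using that by (simp add: power2_norm_eq_inner inner_diff_left inner_diff_right inner_commute)
  have bound: "norm (z0 - z n) \<le> norm (z0 - w)" if "w \<in> Z" for n w
  proof (rule power2_le_imp_le)
    show "(norm (z0 - z n))\<^sup>2 \<le> (norm (z0 - w))\<^sup>2"
      using pyth[OF var[OF that, of n]] zero_le_power2[of "norm (z n - w)"] by linarith
  qed simp
  \<comment> \<open>Telescoping: as \<open>z (Suc n)\<close> lies in the first half-space, the
    squared distance to \<open>z0\<close> grows by at least the squared increment.\<close>
  have partial: "(\<Sum>k<n. (norm (z (Suc k) - z k))\<^sup>2) \<le> (norm (z0 - z n))\<^sup>2" for n
  proof (induction n)
    case (Suc n)
    then show ?case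
      using pyth[OF half1[of n]] by (simp add: norm_minus_commute)
  qed simp
  have sum1: "summable (\<lambda>n. (norm (z (Suc n) - z n))\<^sup>2)"
  proof (rule summableI_nonneg_bounded)
    show "(\<Sum>k<n. (norm (z (Suc k) - z k))\<^sup>2) \<le> (norm (z0 - w0))\<^sup>2" for n
      using order_trans[OF partial power_mono[OF bound[OF \<open>w0 \<in> Z\<close>]]] by simp
  qed simp
  \<comment> \<open>\<open>T n (z n)\<close> is the projection of \<open>z n\<close> onto the second
    half-space, which contains \<open>z (Suc n)\<close>.\<close>
  have "(norm (z n - T n (z n)))\<^sup>2 \<le> (norm (z (Suc n) - z n))\<^sup>2" for n
    using pyth[OF half2[of n]] zero_le_power2[of "norm (T n (z n) - z (Suc n))"]
    unfolding norm_minus_commute[of "z (Suc n)" "z n"] by linarith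
  then have "summable (\<lambda>n. (norm (z n - T n (z n)))\<^sup>2)"
    by (intro summable_comparison_test'[OF sum1]) simp
  with it bound sum1 show thesis
    using that by blast
qed

section \<open>The Kuhn--Tucker set as an intersection of half-spaces\<close>

lemma kuhn_tucker_set_nonempty:
  assumes "0 \<in> A x + adjoint L ` B (L x)"
  shows "kuhn_tucker_set A B L \<noteq> {}"
proof -
  obtain u v where "u \<in> A x" "v \<in> B (L x)" "0 = u + adjoint L v"
    using assms by (auto simp: set_plus_def)
  moreover from this have "u = - adjoint L v"
    by (simp add: eq_neg_iff_add_eq_0)
  ultimately have "(x, v) \<in> kuhn_tucker_set A B L"
    by (simp add: kuhn_tucker_set_def op_inverse_def)
  then show ?thesis
    by blast
qed

definition kt_gap :: "('h::real_inner \<Rightarrow> 'g::real_inner) \<Rightarrow> 'h \<Rightarrow> 'h \<Rightarrow> 'g \<Rightarrow> 'g \<Rightarrow> 'h \<times> 'g \<Rightarrow> real" where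
  "kt_gap L y p q w z =
     (fst z - y) \<bullet> (- adjoint L (snd z) - p) + (L (fst z) - q) \<bullet> (snd z - w)"

locale monotone_inclusion =
  fixes A :: "'h::{real_inner, complete_space} \<Rightarrow> 'h set"
    and B :: "'g::{real_inner, complete_space} \<Rightarrow> 'g set"
    and L :: "'h \<Rightarrow> 'g"
  assumes A: "maximally_monotone A" and B: "maximally_monotone B" and L: "bounded_linear L"
begin

text \<open>With \<open>z = (x, v)\<close>, the terms \<open>- (x \<bullet> adjoint L v)\<close> and
  \<open>L x \<bullet> v\<close> cancel, and every other term is linear in \<open>z\<close> or
  constant.\<close>

lemma kt_gap_affine:
  "kt_gap L y p q w z = (- (p + adjoint L w), L y - q) \<bullet> z + (y \<bullet> p + q \<bullet> w)"
  unfolding kt_gap_def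
  by (cases z) (simp add: inner_diff_left inner_diff_right inner_add_left inner_add_right
      adjoint_inner[OF L] inner_commute[of "adjoint L w"] inner_commute[of p]
      linear_diff[OF bounded_linear.linear[OF L]])

text \<open>
  If the first inner product in \<open>kt_gap\<close> were negative for some \<open>(y, p)\<close>, the second would be
  positive for all \<open>(q, w)\<close>, so that \<open>v \<in> B (L x)\<close>; but it vanishes at \<open>(L x, v)\<close>.
\<close>

lemma kuhn_tucker_set_iff:
  "z \<in> kuhn_tucker_set A B L \<longleftrightarrow> (\<forall>y p q w. p \<in> A y \<longrightarrow> w \<in> B q \<longrightarrow> 0 \<le> kt_gap L y p q w z)"
proof -
  obtain x v where z: "z = (x, v)"
    by (metis prod.exhaust)
  have KT: "z \<in> kuhn_tucker_set A B L \<longleftrightarrow> - adjoint L v \<in> A x \<and> v \<in> B (L x)"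
    by (simp add: kuhn_tucker_set_def op_inverse_def z)
  show ?thesis
    unfolding KT
  proof (intro iffI allI impI)
    fix y p q w
    assume "- adjoint L v \<in> A x \<and> v \<in> B (L x)" "p \<in> A y" "w \<in> B q"
    then show "0 \<le> kt_gap L y p q w z"
      unfolding kt_gap_def using maximally_monotoneD[OF A] maximally_monotoneD[OF B]
      by (simp add: z)
  next
    assume gap: "\<forall>y p q w. p \<in> A y \<longrightarrow> w \<in> B q \<longrightarrow> 0 \<le> kt_gap L y p q w z"
    then have gap': "0 \<le> (x - y) \<bullet> (- adjoint L v - p) + (L x - q) \<bullet> (v - w)"
      if "p \<in> A y" "w \<in> B q" for y p q w
      using that by (force simp: kt_gap_def z)
    have "- adjoint L v \<in> A x"
    proof (rule maximally_monotone_mem[OF A], rule ccontr)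
      fix y p
      assume "p \<in> A y" and neg: "\<not> 0 \<le> (x - y) \<bullet> (- adjoint L v - p)"
      have "v \<in> B (L x)"
        by (rule maximally_monotone_mem[OF B]) (use gap'[OF \<open>p \<in> A y\<close>] neg in fastforce)
      from gap'[OF \<open>p \<in> A y\<close> this] neg show False
        by simp
    qed
    \<comment> \<open>Taking \<open>(y, p) = (x, - adjoint L v)\<close> makes the first product
      vanish.\<close>
    moreover from gap'[OF this] have "v \<in> B (L x)"
      by (intro maximally_monotone_mem[OF B]) simp
    ultimately show "- adjoint L v \<in> A x \<and> v \<in> B (L x)"
      by simp
  qed
qed

lemma halfspace_kt_gap:
  shows closed_kt_gap: "closed {z. r \<le> kt_gap L y p q w z}"
    and convex_kt_gap: "convex {z. r \<le> kt_gap L y p q w z}"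
proof -
  have "{z. r \<le> kt_gap L y p q w z} =
      {z. r - (y \<bullet> p + q \<bullet> w) \<le> (- (p + adjoint L w), L y - q) \<bullet> z}"
    by (simp only: kt_gap_affine diff_le_eq)
  then show "closed {z. r \<le> kt_gap L y p q w z}" "convex {z. r \<le> kt_gap L y p q w z}"
    using closed_halfspace_ge convex_halfspace_ge by metis+
qed

lemma kuhn_tucker_set_closed_convex:
  "closed (kuhn_tucker_set A B L)" "convex (kuhn_tucker_set A B L)"
proof -
  have eq: "kuhn_tucker_set A B L =
      (\<Inter>y. \<Inter>p\<in>A y. \<Inter>q. \<Inter>w\<in>B q. {z. 0 \<le> kt_gap L y p q w z})"
    by (auto simp: kuhn_tucker_set_iff)
  show "closed (kuhn_tucker_set A B L)"
    unfolding eq by (intro closed_INT ballI closed_kt_gap)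
  show "convex (kuhn_tucker_set A B L)"
    unfolding eq by (intro convex_INT convex_kt_gap)
qed

end

section \<open>One iteration\<close>

text \<open>The resolvent puts
  \<open>(x - \<alpha>, inverse \<gamma> *\<^sub>R \<alpha> + c)\<close> on the graph, not
  \<open>(x, c)\<close>. The error is of first order in \<open>norm \<alpha>\<close>, since the
  quadratic term has a favourable sign and is dropped.\<close>

lemma monotone_perturbation:
  fixes \<alpha> x y c p :: "'a::real_inner"
  assumes "0 < \<gamma>" and mono: "0 \<le> (x - \<alpha> - y) \<bullet> (inverse \<gamma> *\<^sub>R \<alpha> + c - p)"
  shows "- (norm \<alpha> * (norm (x - y) / \<gamma> + norm (c - p))) \<le> (x - y) \<bullet> (c - p)"
proof -
  define u where "u = x - y"
  define e where "e = c - p"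
  have "0 \<le> (u - \<alpha>) \<bullet> (inverse \<gamma> *\<^sub>R \<alpha> + e)"
    using mono by (simp add: u_def e_def algebra_simps)
  also have "\<dots> = inverse \<gamma> * (u \<bullet> \<alpha>) - inverse \<gamma> * (\<alpha> \<bullet> \<alpha>) + u \<bullet> e - \<alpha> \<bullet> e"
    by (simp add: inner_diff_left inner_add_right right_diff_distrib)
  also have "\<dots> \<le> inverse \<gamma> * (norm u * norm \<alpha>) + u \<bullet> e + norm \<alpha> * norm e"
  proof -
    have "inverse \<gamma> * (u \<bullet> \<alpha>) \<le> inverse \<gamma> * (norm u * norm \<alpha>)"
      using \<open>0 < \<gamma>\<close> norm_cauchy_schwarz by (intro mult_left_mono) auto
    moreover have "0 \<le> inverse \<gamma> * (\<alpha> \<bullet> \<alpha>)"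
      using \<open>0 < \<gamma>\<close> by simp
    moreover have "- (\<alpha> \<bullet> e) \<le> norm \<alpha> * norm e"
      using Cauchy_Schwarz_ineq2[of \<alpha> e] by linarith
    ultimately show ?thesis
      by linarith
  qed
  finally show ?thesis
    by (simp add: u_def e_def divide_inverse algebra_simps)
qed

lemma norm_add_power2_le:
  fixes a b :: "'a::real_inner"
  shows "(norm (a + b))\<^sup>2 \<le> 2 * (norm a)\<^sup>2 + 2 * (norm b)\<^sup>2"
  using zero_le_power2[of "norm (a - b)"]
  by (simp add: power2_norm_eq_inner inner_simps inner_commute)

text \<open>With \<open>d\<close> the direction at \<open>z\<close>, this is the amount by which
  \<open>z\<close> violates the half-space of all \<open>w\<close> with
  \<open>cut_depth \<le> (z - w) \<bullet> d\<close>. It is the numerator of \<open>theta\<close>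
  without \<open>lam\<close>.\<close>

definition cut_depth ::
  "('h::real_inner \<Rightarrow> 'h set) \<Rightarrow> ('g::real_inner \<Rightarrow> 'g set) \<Rightarrow> ('h \<Rightarrow> 'g) \<Rightarrow>
   real \<Rightarrow> real \<Rightarrow> 'h \<Rightarrow> 'g \<Rightarrow> real" where
  "cut_depth A B L \<gamma> \<mu> x v =
     inverse \<gamma> * (norm (x - pt_a A L \<gamma> x v))\<^sup>2 + inverse \<mu> * (norm (L x - pt_b B L \<mu> x v))\<^sup>2"

definition direction ::
  "('h::real_inner \<Rightarrow> 'h set) \<Rightarrow> ('g::real_inner \<Rightarrow> 'g set) \<Rightarrow> ('h \<Rightarrow> 'g) \<Rightarrow>
   real \<Rightarrow> real \<Rightarrow> 'h \<times> 'g \<Rightarrow> 'h \<times> 'g" where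
  "direction A B L \<gamma> \<mu> z =
     (dir_s A B L \<gamma> \<mu> (fst z) (snd z), dir_t A B L \<gamma> \<mu> (fst z) (snd z))"

lemma half_step_eq:
  "half_step A B L \<gamma> \<mu> lam z =
     z - theta A B L \<gamma> \<mu> lam (fst z) (snd z) *\<^sub>R direction A B L \<gamma> \<mu> z"
  by (cases z) (simp add: half_step_def direction_def)

lemma tau_eq: "tau A B L \<gamma> \<mu> (fst z) (snd z) = (norm (direction A B L \<gamma> \<mu> z))\<^sup>2"
  by (simp add: tau_def direction_def power2_norm_eq_inner)

lemma tau_nonneg: "0 \<le> tau A B L \<gamma> \<mu> x v"
  by (simp add: tau_def)

lemma cut_depth_nonneg: "0 < \<gamma> \<Longrightarrow> 0 < \<mu> \<Longrightarrow> 0 \<le> cut_depth A B L \<gamma> \<mu> x v"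
  by (simp add: cut_depth_def)

lemma theta_eq:
  "theta A B L \<gamma> \<mu> lam x v =
     (if tau A B L \<gamma> \<mu> x v = 0 then 0 else lam * cut_depth A B L \<gamma> \<mu> x v / tau A B L \<gamma> \<mu> x v)"
  by (simp add: theta_def cut_depth_def)

context monotone_inclusion
begin

lemma pt_a_mem:
  assumes "0 < \<gamma>"
  shows "inverse \<gamma> *\<^sub>R (x - pt_a A L \<gamma> x v) - adjoint L v \<in> A (pt_a A L \<gamma> x v)"
  using resolvent_fun_mem[OF A assms, of "x - \<gamma> *\<^sub>R adjoint L v"] assms
  unfolding pt_a_def[symmetric] by (simp add: scaleR_diff_right algebra_simps)

lemma pt_b_mem:
  assumes "0 < \<mu>"
  shows "inverse \<mu> *\<^sub>R (L x - pt_b B L \<mu> x v) + v \<in> B (pt_b B L \<mu> x v)"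
  using resolvent_fun_mem[OF B assms, of "L x + \<mu> *\<^sub>R v"] assms
  unfolding pt_b_def[symmetric] by (simp add: scaleR_diff_right scaleR_add_right algebra_simps)

text \<open>The difference of the two sides is exactly the sum of two monotonicity products: the
  resolvent points of \<open>A\<close> and \<open>B\<close> against the graph points
  \<open>(xb, - adjoint L vb)\<close> and \<open>(L xb, vb)\<close> given by
  \<open>w = (xb, vb)\<close>.\<close>

lemma cut_depth_le_inner:
  assumes "0 < \<gamma>" "0 < \<mu>" and kt: "w \<in> kuhn_tucker_set A B L"
  shows "cut_depth A B L \<gamma> \<mu> (fst z) (snd z) \<le> (z - w) \<bullet> direction A B L \<gamma> \<mu> z"
proof -
  obtain x v xb vb where z: "z = (x, v)" and w: "w = (xb, vb)"
    by (metis prod.exhaust)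
  interpret L: bounded_linear L
    by (rule L)
  define \<alpha> where "\<alpha> = x - pt_a A L \<gamma> x v"
  define \<beta> where "\<beta> = L x - pt_b B L \<mu> x v"
  have a: "pt_a A L \<gamma> x v = x - \<alpha>" and b: "pt_b B L \<mu> x v = L x - \<beta>"
    by (simp_all add: \<alpha>_def \<beta>_def)
  have "0 \<le> (x - \<alpha> - xb) \<bullet> (inverse \<gamma> *\<^sub>R \<alpha> - adjoint L v - (- adjoint L vb))"
    using maximally_monotoneD[OF A pt_a_mem[OF \<open>0 < \<gamma>\<close>, of x v], of "- adjoint L vb" xb] kt
    by (simp add: a kuhn_tucker_set_def w)
  moreover have "0 \<le> (L x - \<beta> - L xb) \<bullet> (inverse \<mu> *\<^sub>R \<beta> + v - vb)"
    using maximally_monotoneD[OF B pt_b_mem[OF \<open>0 < \<mu>\<close>, of x v], of vb "L xb"] kt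
    by (simp add: b kuhn_tucker_set_def op_inverse_def w)
  moreover have "(z - w) \<bullet> direction A B L \<gamma> \<mu> z - cut_depth A B L \<gamma> \<mu> x v =
      (x - \<alpha> - xb) \<bullet> (inverse \<gamma> *\<^sub>R \<alpha> - adjoint L v - (- adjoint L vb)) +
      (L x - \<beta> - L xb) \<bullet> (inverse \<mu> *\<^sub>R \<beta> + v - vb)"
    by (simp add: z w direction_def dir_s_def dir_t_def cut_depth_def a b power2_norm_eq_inner
        inner_diff_left inner_diff_right inner_add_left inner_add_right adjoint_inner[OF L]
        L.diff L.add inner_commute algebra_simps)
  ultimately show ?thesis
    by (simp add: z)
qed

text \<open>Both components of the direction are linear in the two residuals. The factor 2 comes
  from squaring a sum, \<open>1 / \<epsilon>\<close> bounds the step sizes as well as their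
  inverses, and \<open>K\<close> bounds \<open>L\<close> and its adjoint.\<close>

lemma tau_le_cut_depth:
  assumes \<epsilon>: "0 < \<epsilon>" "\<gamma> \<in> {\<epsilon>..1 / \<epsilon>}" "\<mu> \<in> {\<epsilon>..1 / \<epsilon>}"
    and K: "\<And>x. norm (L x) \<le> K * norm x" "0 \<le> K"
  shows "tau A B L \<gamma> \<mu> x v \<le> 2 / \<epsilon> * (1 + K\<^sup>2) * cut_depth A B L \<gamma> \<mu> x v"
proof -
  interpret L: bounded_linear L
    by (rule L)
  define \<alpha> where "\<alpha> = x - pt_a A L \<gamma> x v"
  define \<beta> where "\<beta> = L x - pt_b B L \<mu> x v"
  define s1 where "s1 = inverse \<gamma> * (norm \<alpha>)\<^sup>2"
  define s2 where "s2 = inverse \<mu> * (norm \<beta>)\<^sup>2"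
  have pos: "0 < \<gamma>" "0 < \<mu>"
    using \<epsilon> by auto
  have inv: "inverse \<gamma> \<le> 1 / \<epsilon>" "inverse \<mu> \<le> 1 / \<epsilon>"
    using \<epsilon> by (auto simp: inverse_eq_divide intro!: frac_le)
  have \<alpha>2: "(norm \<alpha>)\<^sup>2 = \<gamma> * s1" and \<beta>2: "(norm \<beta>)\<^sup>2 = \<mu> * s2"
    using pos by (simp_all add: s1_def s2_def)
  have s: "0 \<le> s1" "0 \<le> s2"
    using pos by (simp_all add: s1_def s2_def)
  have L2: "(norm (L y))\<^sup>2 \<le> K\<^sup>2 * (norm y)\<^sup>2" for y
    using power_mono[OF K(1), of y 2] by (simp add: power_mult_distrib)
  have L'2: "(norm (adjoint L y))\<^sup>2 \<le> K\<^sup>2 * (norm y)\<^sup>2" for y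
    using power_mono[OF norm_adjoint_le[OF L K], of y 2] by (simp add: power_mult_distrib)
  have "(norm (dir_s A B L \<gamma> \<mu> x v))\<^sup>2 \<le>
      2 * ((inverse \<gamma>)\<^sup>2 * (norm \<alpha>)\<^sup>2) + 2 * ((inverse \<mu>)\<^sup>2 * (norm (adjoint L \<beta>))\<^sup>2)"
    unfolding dir_s_def \<alpha>_def[symmetric] \<beta>_def[symmetric]
    using norm_add_power2_le[of "inverse \<gamma> *\<^sub>R \<alpha>" "inverse \<mu> *\<^sub>R adjoint L \<beta>"] pos
    by (simp add: power_mult_distrib)
  also have "\<dots> \<le> 2 * ((inverse \<gamma>)\<^sup>2 * (norm \<alpha>)\<^sup>2) + 2 * ((inverse \<mu>)\<^sup>2 * (K\<^sup>2 * (norm \<beta>)\<^sup>2))"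
    using L'2 by (intro add_left_mono mult_left_mono) auto
  also have "\<dots> = 2 * (inverse \<gamma> * s1) + 2 * (inverse \<mu> * (K\<^sup>2 * s2))"
    by (simp add: s1_def s2_def power2_eq_square mult_ac)
  also have "\<dots> \<le> 2 * (1 / \<epsilon> * s1) + 2 * (1 / \<epsilon> * (K\<^sup>2 * s2))"
    using s inv by (intro add_mono mult_left_mono mult_right_mono) auto
  finally have 1: "(norm (dir_s A B L \<gamma> \<mu> x v))\<^sup>2 \<le> 2 * (1 / \<epsilon> * s1) + 2 * (1 / \<epsilon> * (K\<^sup>2 * s2))" .
  have "dir_t A B L \<gamma> \<mu> x v = - \<beta> + L \<alpha>"
    by (simp add: dir_t_def \<alpha>_def \<beta>_def L.diff)
  then have "(norm (dir_t A B L \<gamma> \<mu> x v))\<^sup>2 \<le> 2 * (norm \<beta>)\<^sup>2 + 2 * (norm (L \<alpha>))\<^sup>2"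
    using norm_add_power2_le[of "- \<beta>" "L \<alpha>"] by simp
  also have "\<dots> \<le> 2 * (\<mu> * s2) + 2 * (K\<^sup>2 * (\<gamma> * s1))"
    using L2[of \<alpha>] by (simp add: \<alpha>2 \<beta>2)
  also have "\<dots> \<le> 2 * (1 / \<epsilon> * s2) + 2 * (K\<^sup>2 * (1 / \<epsilon> * s1))"
    using s \<epsilon> by (intro add_mono mult_left_mono mult_right_mono) auto
  finally have "tau A B L \<gamma> \<mu> x v \<le>
      2 * (1 / \<epsilon> * s1) + 2 * (1 / \<epsilon> * (K\<^sup>2 * s2)) + (2 * (1 / \<epsilon> * s2) + 2 * (K\<^sup>2 * (1 / \<epsilon> * s1)))"
    unfolding tau_def using 1 by linarith
  also have "\<dots> = 2 / \<epsilon> * (1 + K\<^sup>2) * (s1 + s2)"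
    by (simp add: algebra_simps add_divide_distrib)
  finally show ?thesis
    by (simp add: cut_depth_def s1_def s2_def \<alpha>_def \<beta>_def)
qed

text \<open>Because \<open>lam\<close> is at most 1, the step does not overshoot:
  \<open>\<theta> * (d \<bullet> d) = lam * \<sigma>\<close>, which is at most
  \<open>(z - w) \<bullet> d\<close>. For vanishing \<open>tau\<close> the step is zero and the
  inequality is trivial.\<close>

lemma half_step_cut:
  assumes pos: "0 < \<gamma>" "0 < \<mu>" and kt: "w \<in> kuhn_tucker_set A B L"
    and lam: "tau A B L \<gamma> \<mu> (fst z) (snd z) > 0 \<Longrightarrow> 0 \<le> lam \<and> lam \<le> 1"
  shows "(w - half_step A B L \<gamma> \<mu> lam z) \<bullet> (z - half_step A B L \<gamma> \<mu> lam z) \<le> 0"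
proof (cases "tau A B L \<gamma> \<mu> (fst z) (snd z) = 0")
  case True
  then show ?thesis
    by (simp add: half_step_eq theta_eq)
next
  case False
  define d where "d = direction A B L \<gamma> \<mu> z"
  define \<sigma> where "\<sigma> = cut_depth A B L \<gamma> \<mu> (fst z) (snd z)"
  define \<theta> where "\<theta> = theta A B L \<gamma> \<mu> lam (fst z) (snd z)"
  have "0 < tau A B L \<gamma> \<mu> (fst z) (snd z)"
    using False tau_nonneg less_le by metis
  with lam have lam': "0 \<le> lam" "lam \<le> 1"
    by auto
  have "0 \<le> \<sigma>"
    unfolding \<sigma>_def by (rule cut_depth_nonneg[OF pos])
  have "\<theta> * (d \<bullet> d) = lam * \<sigma>"
    using False by (simp add: \<theta>_def theta_eq \<sigma>_def d_def tau_eq power2_norm_eq_inner)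
  also have "\<dots> \<le> \<sigma>"
    using lam' \<open>0 \<le> \<sigma>\<close> by (simp add: mult_left_le_one_le)
  also have "\<sigma> \<le> (z - w) \<bullet> d"
    unfolding \<sigma>_def d_def by (rule cut_depth_le_inner[OF pos kt])
  finally have "(w - z + \<theta> *\<^sub>R d) \<bullet> d \<le> 0"
    by (simp add: inner_simps)
  moreover have "0 \<le> \<theta>"
    unfolding \<theta>_def theta_eq using lam' \<open>0 \<le> \<sigma>\<close>
    by (auto intro!: divide_nonneg_nonneg mult_nonneg_nonneg tau_nonneg simp: \<sigma>_def)
  ultimately have "\<theta> * ((w - z + \<theta> *\<^sub>R d) \<bullet> d) \<le> 0"
    by (simp add: mult_nonneg_nonpos)
  then show ?thesis
    by (simp add: half_step_eq d_def \<theta>_def algebra_simps)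
qed

lemma cut_depth_le_half_step:
  assumes pos: "0 < \<gamma>" "0 < \<mu>" and kt: "kuhn_tucker_set A B L \<noteq> {}"
    and "0 < \<epsilon>" and lam: "tau A B L \<gamma> \<mu> (fst z) (snd z) > 0 \<Longrightarrow> \<epsilon> \<le> lam"
    and tau: "tau A B L \<gamma> \<mu> (fst z) (snd z) \<le> C * cut_depth A B L \<gamma> \<mu> (fst z) (snd z)" and "0 < C"
  shows "cut_depth A B L \<gamma> \<mu> (fst z) (snd z) \<le> C / \<epsilon>\<^sup>2 * (norm (z - half_step A B L \<gamma> \<mu> lam z))\<^sup>2"
proof (cases "tau A B L \<gamma> \<mu> (fst z) (snd z) = 0")
  case True
  \<comment> \<open>Here the direction is zero, so comparison with any Kuhn-Tucker point forces the
    depth to be nonpositive.\<close>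
  obtain w where w: "w \<in> kuhn_tucker_set A B L"
    using kt by blast
  have "cut_depth A B L \<gamma> \<mu> (fst z) (snd z) \<le> 0"
    using cut_depth_le_inner[OF pos w, of z] True by (simp add: tau_eq)
  also have "0 \<le> C / \<epsilon>\<^sup>2 * (norm (z - half_step A B L \<gamma> \<mu> lam z))\<^sup>2"
    using \<open>0 < C\<close> by simp
  finally show ?thesis .
next
  case False
  define d where "d = direction A B L \<gamma> \<mu> z"
  define \<tau> where "\<tau> = tau A B L \<gamma> \<mu> (fst z) (snd z)"
  define \<sigma> where "\<sigma> = cut_depth A B L \<gamma> \<mu> (fst z) (snd z)"
  have "0 < \<tau>"
    using False tau_nonneg less_le unfolding \<tau>_def by metis
  then have "\<epsilon> \<le> lam"
    using lam by (simp add: \<tau>_def)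
  have "0 \<le> \<sigma>"
    unfolding \<sigma>_def by (rule cut_depth_nonneg[OF pos])
  have "z - half_step A B L \<gamma> \<mu> lam z = (lam * \<sigma> / \<tau>) *\<^sub>R d"
    using False by (simp add: half_step_eq theta_eq \<sigma>_def \<tau>_def d_def)
  then have "(norm (z - half_step A B L \<gamma> \<mu> lam z))\<^sup>2 = (lam * \<sigma> / \<tau>)\<^sup>2 * \<tau>"
    by (simp only: norm_scaleR power_mult_distrib power2_abs \<tau>_def tau_eq d_def)
  also have "\<dots> = lam\<^sup>2 * \<sigma>\<^sup>2 / \<tau>"
    using \<open>0 < \<tau>\<close> by (simp add: power_mult_distrib power_divide power2_eq_square)
  finally have step: "(norm (z - half_step A B L \<gamma> \<mu> lam z))\<^sup>2 * \<tau> = lam\<^sup>2 * \<sigma>\<^sup>2"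
    using \<open>0 < \<tau>\<close> by simp
  \<comment> \<open>Multiplying by \<sigma> and cancelling the positive \<tau> at the end avoids a
    separate case for vanishing \<sigma>.\<close>
  have "\<tau> * (\<epsilon>\<^sup>2 * \<sigma>) \<le> C * \<sigma> * (\<epsilon>\<^sup>2 * \<sigma>)"
    using tau \<open>0 \<le> \<sigma>\<close> by (intro mult_right_mono) (auto simp: \<tau>_def \<sigma>_def)
  also have "\<dots> = C * (\<epsilon>\<^sup>2 * \<sigma>\<^sup>2)"
    by (simp add: power2_eq_square)
  also have "\<dots> \<le> C * (lam\<^sup>2 * \<sigma>\<^sup>2)"
    using \<open>0 < C\<close> \<open>0 < \<epsilon>\<close> \<open>\<epsilon> \<le> lam\<close> by (intro mult_left_mono mult_right_mono power_mono) auto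
  also have "\<dots> = \<tau> * (C * (norm (z - half_step A B L \<gamma> \<mu> lam z))\<^sup>2)"
    unfolding step[symmetric] by (simp add: mult_ac)
  finally have "\<epsilon>\<^sup>2 * \<sigma> \<le> C * (norm (z - half_step A B L \<gamma> \<mu> lam z))\<^sup>2"
    using \<open>0 < \<tau>\<close> by simp
  then show ?thesis
    using \<open>0 < \<epsilon>\<close> by (simp add: \<sigma>_def field_simps)
qed

lemma kt_gap_lower:
  assumes pos: "0 < \<gamma>" "0 < \<mu>" and "p \<in> A y" "w \<in> B q"
  shows "- (norm (x - pt_a A L \<gamma> x v) * (norm (x - y) / \<gamma> + norm (- adjoint L v - p)) +
            norm (L x - pt_b B L \<mu> x v) * (norm (L x - q) / \<mu> + norm (v - w)))
         \<le> kt_gap L y p q w (x, v)"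
proof -
  have "- (norm (x - pt_a A L \<gamma> x v) * (norm (x - y) / \<gamma> + norm (- adjoint L v - p)))
      \<le> (x - y) \<bullet> (- adjoint L v - p)"
    by (rule monotone_perturbation[OF pos(1)])
      (use maximally_monotoneD[OF A pt_a_mem[OF pos(1), of x v] \<open>p \<in> A y\<close>] in simp)
  moreover have "- (norm (L x - pt_b B L \<mu> x v) * (norm (L x - q) / \<mu> + norm (v - w)))
      \<le> (L x - q) \<bullet> (v - w)"
    by (rule monotone_perturbation[OF pos(2)])
      (use maximally_monotoneD[OF B pt_b_mem[OF pos(2), of x v] \<open>w \<in> B q\<close>] in simp)
  ultimately show ?thesis
    by (simp add: kt_gap_def)
qed

text \<open>A point outside the Kuhn-Tucker set violates one of its affine inequalities, while along
  the sequence the same inequality holds up to an error that vanishes with the residuals.\<close>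

lemma asymptotically_kuhn_tucker:
  fixes x :: "nat \<Rightarrow> 'h" and v :: "nat \<Rightarrow> 'g"
  assumes "0 < \<epsilon>" and \<gamma>: "\<And>n. \<epsilon> \<le> \<gamma> n" and \<mu>: "\<And>n. \<epsilon> \<le> \<mu> n"
    and x: "\<And>n. norm (x n) \<le> R" and v: "\<And>n. norm (v n) \<le> R"
    and a: "(\<lambda>n. norm (x n - pt_a A L (\<gamma> n) (x n) (v n))) \<longlonglongrightarrow> 0"
    and b: "(\<lambda>n. norm (L (x n) - pt_b B L (\<mu> n) (x n) (v n))) \<longlonglongrightarrow> 0"
    and "z \<notin> kuhn_tucker_set A B L"
  shows "\<exists>S. closed S \<and> convex S \<and> z \<notin> S \<and> (\<forall>\<^sub>F n in sequentially. (x n, v n) \<in> S)"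
proof -
  obtain y p q w where "p \<in> A y" "w \<in> B q" and neg: "kt_gap L y p q w z < 0"
    using \<open>z \<notin> kuhn_tucker_set A B L\<close> by (auto simp: kuhn_tucker_set_iff not_le)
  \<comment> \<open>Half of the negative gap leaves room on both sides: \<open>z\<close> stays
    outside \<open>S\<close>, and a lower bound tending to 0 eventually exceeds the
    threshold.\<close>
  define S where "S = {z'. kt_gap L y p q w z / 2 \<le> kt_gap L y p q w z'}"
  obtain K where K: "0 \<le> K" "\<And>x. norm (L x) \<le> K * norm x"
    using bounded_linear.nonneg_bounded[OF L] by (metis mult.commute)
  define \<alpha> where "\<alpha> = (\<lambda>n. norm (x n - pt_a A L (\<gamma> n) (x n) (v n)))"
  define \<beta> where "\<beta> = (\<lambda>n. norm (L (x n) - pt_b B L (\<mu> n) (x n) (v n)))"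
  \<comment> \<open>\<open>M\<close> and \<open>N\<close> bound the factors that multiply the
    residuals, uniformly in \<open>n\<close>: the iterates are bounded by \<open>R\<close> and the
    step sizes are at least \<epsilon>.\<close>
  define M where "M = (R + norm y) / \<epsilon> + (K * R + norm p)"
  define N where "N = (K * R + norm q) / \<epsilon> + (R + norm w)"
  have lower: "- (\<alpha> n * M + \<beta> n * N) \<le> kt_gap L y p q w (x n, v n)" for n
  proof -
    have pos: "0 < \<gamma> n" "0 < \<mu> n"
      using \<open>0 < \<epsilon>\<close> \<gamma>[of n] \<mu>[of n] by linarith+
    have L_le: "norm (L (x n)) \<le> K * R" and L'_le: "norm (adjoint L (v n)) \<le> K * R"
      using order_trans[OF K(2) mult_left_mono[OF x K(1)]]
        order_trans[OF norm_adjoint_le[OF L K(2,1)] mult_left_mono[OF v K(1)]] by blast+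
    have "norm (x n - y) / \<gamma> n \<le> (R + norm y) / \<epsilon>"
      using \<open>0 < \<epsilon>\<close> \<gamma> order_trans[OF norm_triangle_ineq4 add_right_mono[OF x]]
      by (intro frac_le) (auto intro: order_trans[OF norm_ge_zero])
    moreover have "norm (- adjoint L (v n) - p) \<le> K * R + norm p"
      using norm_triangle_ineq4[of "- adjoint L (v n)" p] L'_le by simp
    ultimately have "norm (x n - y) / \<gamma> n + norm (- adjoint L (v n) - p) \<le> M"
      unfolding M_def by (rule add_mono)
    moreover have "norm (L (x n) - q) / \<mu> n \<le> (K * R + norm q) / \<epsilon>"
      using \<open>0 < \<epsilon>\<close> \<mu> order_trans[OF norm_triangle_ineq4 add_right_mono[OF L_le]]
      by (intro frac_le) (auto intro: order_trans[OF norm_ge_zero])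
    moreover have "norm (v n - w) \<le> R + norm w"
      using norm_triangle_ineq4[of "v n" w] v[of n] by simp
    ultimately have "\<alpha> n * (norm (x n - y) / \<gamma> n + norm (- adjoint L (v n) - p)) +
        \<beta> n * (norm (L (x n) - q) / \<mu> n + norm (v n - w)) \<le> \<alpha> n * M + \<beta> n * N"
      unfolding N_def by (intro add_mono mult_left_mono) (auto simp: \<alpha>_def \<beta>_def)
    then show ?thesis
      using kt_gap_lower[OF pos \<open>p \<in> A y\<close> \<open>w \<in> B q\<close>, of "x n" "v n"]
      unfolding \<alpha>_def \<beta>_def by linarith
  qed
  have "(\<lambda>n. - (\<alpha> n * M + \<beta> n * N)) \<longlonglongrightarrow> - (0 * M + 0 * N)"
    unfolding \<alpha>_def \<beta>_def by (intro tendsto_intros a b)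
  then have "\<forall>\<^sub>F n in sequentially. kt_gap L y p q w z / 2 < - (\<alpha> n * M + \<beta> n * N)"
    using neg by (intro order_tendstoD(1)) auto
  then have "\<forall>\<^sub>F n in sequentially. (x n, v n) \<in> S"
  proof (rule eventually_mono)
    show "(x n, v n) \<in> S" if "kt_gap L y p q w z / 2 < - (\<alpha> n * M + \<beta> n * N)" for n
      using that lower[of n] by (simp add: S_def)
  qed
  moreover have "closed S" "convex S"
    unfolding S_def by (rule closed_kt_gap convex_kt_gap)+
  moreover have "z \<notin> S"
    using neg by (simp add: S_def)
  ultimately show ?thesis
    by blast
qed

end

section \<open>Convergence\<close>

lemma summable_power2_imp_tendsto_zero:
  fixes f :: "nat \<Rightarrow> 'a::real_normed_vector"
  assumes "summable (\<lambda>n. (norm (f n))\<^sup>2)"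
  shows "(\<lambda>n. norm (f n)) \<longlonglongrightarrow> 0"
  using tendsto_real_sqrt[OF summable_LIMSEQ_zero[OF assms]] by simp

theorem proposition3p5:
  fixes A :: "'h::{real_inner, complete_space} \<Rightarrow> 'h set"
    and B :: "'g::{real_inner, complete_space} \<Rightarrow> 'g set"
    and L :: "'h \<Rightarrow> 'g"
    and x0 xbar :: 'h and v0 vbar :: 'g
    and \<epsilon> :: real and \<gamma> \<mu> lam :: "nat \<Rightarrow> real"
  assumes "maximally_monotone A" and "maximally_monotone B"
    and "bounded_linear L"
    and "\<exists>x. 0 \<in> A x + adjoint L ` B (L x)"
    and "(xbar, vbar) = projection (kuhn_tucker_set A B L) (x0, v0)"
    and "0 < \<epsilon>" and "\<epsilon> < 1"
    and "\<And>n. \<gamma> n \<in> {\<epsilon>..1 / \<epsilon>}" and "\<And>n. \<mu> n \<in> {\<epsilon>..1 / \<epsilon>}"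
    and "\<And>n x v. iterate A B L \<gamma> \<mu> lam (x0, v0) n = Some (x, v) \<Longrightarrow>
           tau A B L (\<gamma> n) (\<mu> n) x v > 0 \<Longrightarrow> lam n \<in> {\<epsilon>..1}"
  shows "\<exists>x v.
    (\<forall>n. iterate A B L \<gamma> \<mu> lam (x0, v0) n = Some (x n, v n)) \<and>
    summable (\<lambda>n. (norm (x (Suc n) - x n))\<^sup>2) \<and>
    summable (\<lambda>n. (norm (v (Suc n) - v n))\<^sup>2) \<and>
    summable (\<lambda>n. (norm (dir_s A B L (\<gamma> n) (\<mu> n) (x n) (v n)))\<^sup>2) \<and>
    summable (\<lambda>n. (norm (dir_t A B L (\<gamma> n) (\<mu> n) (x n) (v n)))\<^sup>2) \<and>
    summable (\<lambda>n. (norm (x n - pt_a A L (\<gamma> n) (x n) (v n)))\<^sup>2) \<and>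
    summable (\<lambda>n. (norm (L (x n) - pt_b B L (\<mu> n) (x n) (v n)))\<^sup>2) \<and>
    x \<longlonglongrightarrow> xbar \<and> v \<longlonglongrightarrow> vbar"
proof -
  interpret monotone_inclusion A B L
    by (rule monotone_inclusion.intro) (fact assms(1-3))+
  let ?Z = "kuhn_tucker_set A B L"
  note \<epsilon> = \<open>0 < \<epsilon>\<close> and \<gamma> = assms(8) and \<mu> = assms(9) and lam = assms(10)
  have \<gamma>_ge: "\<epsilon> \<le> \<gamma> n" and \<mu>_ge: "\<epsilon> \<le> \<mu> n"
    and \<gamma>_le: "\<gamma> n \<le> 1 / \<epsilon>" and \<mu>_le: "\<mu> n \<le> 1 / \<epsilon>" for n
    using \<gamma>[of n] \<mu>[of n] by auto
  have pos: "0 < \<gamma> n" "0 < \<mu> n" for n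
    using \<epsilon> \<gamma>_ge[of n] \<mu>_ge[of n] by linarith+
  have ne: "?Z \<noteq> {}"
    using assms(4) kuhn_tucker_set_nonempty by blast
  obtain K where K: "0 \<le> K" "\<And>x. norm (L x) \<le> K * norm x"
    using bounded_linear.nonneg_bounded[OF \<open>bounded_linear L\<close>] by (metis mult.commute)
  define T where "T = (\<lambda>n. half_step A B L (\<gamma> n) (\<mu> n) (lam n))"
  obtain z where it: "\<And>n. iterate A B L \<gamma> \<mu> lam (x0, v0) n = Some (z n)"
    and bound: "\<And>n w. w \<in> ?Z \<Longrightarrow> norm ((x0, v0) - z n) \<le> norm ((x0, v0) - w)"
    and incr: "summable (\<lambda>n. (norm (z (Suc n) - z n))\<^sup>2)"
    and half: "summable (\<lambda>n. (norm (z n - T n (z n)))\<^sup>2)"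
  proof (rule anchored_iteration[of "iterate A B L \<gamma> \<mu> lam (x0, v0)" "(x0, v0)" T])
    show "iterate A B L \<gamma> \<mu> lam (x0, v0) (Suc n) =
        Option.bind (iterate A B L \<gamma> \<mu> lam (x0, v0) n) (\<lambda>z. anchored_update (x0, v0) z (T n z))" for n
      by (simp add: T_def)
    show "(w - T n z) \<bullet> (z - T n z) \<le> 0"
      if "iterate A B L \<gamma> \<mu> lam (x0, v0) n = Some z" "w \<in> ?Z" for n z w
      unfolding T_def using pos \<open>w \<in> ?Z\<close>
    proof (rule half_step_cut)
      \<comment> \<open>The range of \<open>lam n\<close> is assumed only at iterates that occur and
        have positive \<open>tau\<close>; this is why the cut condition is asked only for
        \<open>z\<close> produced by the iteration.\<close>
      assume "tau A B L (\<gamma> n) (\<mu> n) (fst z) (snd z) > 0"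
      then show "0 \<le> lam n \<and> lam n \<le> 1"
        using lam[of n "fst z" "snd z"] that(1) \<epsilon> by simp
    qed
  qed (use ne in auto)
  define x where "x = (\<lambda>n. fst (z n))"
  define v where "v = (\<lambda>n. snd (z n))"
  have z: "z n = (x n, v n)" for n
    by (simp add: x_def v_def)
  define C where "C = 2 / \<epsilon> * (1 + K\<^sup>2)"
  have "0 < 1 + K\<^sup>2"
    by (simp add: add_pos_nonneg)
  with \<epsilon> have "0 < C"
    by (simp add: C_def)
  define \<sigma> where "\<sigma> = (\<lambda>n. cut_depth A B L (\<gamma> n) (\<mu> n) (x n) (v n))"
  have \<sigma>_nonneg: "0 \<le> \<sigma> n" for n
    unfolding \<sigma>_def by (rule cut_depth_nonneg[OF pos])
  have tau: "tau A B L (\<gamma> n) (\<mu> n) (x n) (v n) \<le> C * \<sigma> n" for n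
    unfolding C_def \<sigma>_def by (rule tau_le_cut_depth[OF \<epsilon> \<gamma> \<mu> K(2,1)])
  have "\<sigma> n \<le> C / \<epsilon>\<^sup>2 * (norm (z n - T n (z n)))\<^sup>2" for n
    unfolding \<sigma>_def T_def x_def v_def
  proof (rule cut_depth_le_half_step[OF pos ne \<epsilon> _ _ \<open>0 < C\<close>])
    show "\<epsilon> \<le> lam n" if "tau A B L (\<gamma> n) (\<mu> n) (fst (z n)) (snd (z n)) > 0"
      using lam[of n "x n" "v n"] that by (simp add: it z)
  qed (use tau[of n] in \<open>simp add: x_def v_def \<sigma>_def\<close>)
  then have sum\<sigma>: "summable \<sigma>"
    using \<sigma>_nonneg by (intro summable_comparison_test'[OF summable_mult[OF half, of "C / \<epsilon>\<^sup>2"]]) simp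
  \<comment> \<open>The depth is the common majorant: \<open>a\<close> and \<open>b\<close> follow
    with constant \<open>1 / \<epsilon>\<close> from the upper bound on the step sizes,
    \<open>s\<close> and \<open>t\<close> with constant \<open>C\<close> through
    \<open>tau\<close>.\<close>
  have by_\<sigma>: "summable f" if "\<And>n. 0 \<le> f n" "\<And>n. f n \<le> c * \<sigma> n" for f and c :: real
    using that by (intro summable_comparison_test'[OF summable_mult[OF sum\<sigma>, of c]]) simp
  have a: "summable (\<lambda>n. (norm (x n - pt_a A L (\<gamma> n) (x n) (v n)))\<^sup>2)"
  proof (rule by_\<sigma>)
    fix n
    have "(norm (x n - pt_a A L (\<gamma> n) (x n) (v n)))\<^sup>2 =
        \<gamma> n * (inverse (\<gamma> n) * (norm (x n - pt_a A L (\<gamma> n) (x n) (v n)))\<^sup>2)"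
      using pos[of n] by simp
    also have "\<dots> \<le> 1 / \<epsilon> * \<sigma> n"
      using pos[of n] \<gamma>_le[of n] \<epsilon> unfolding \<sigma>_def cut_depth_def by (intro mult_mono) auto
    finally show "(norm (x n - pt_a A L (\<gamma> n) (x n) (v n)))\<^sup>2 \<le> 1 / \<epsilon> * \<sigma> n" .
  qed simp
  have b: "summable (\<lambda>n. (norm (L (x n) - pt_b B L (\<mu> n) (x n) (v n)))\<^sup>2)"
  proof (rule by_\<sigma>)
    fix n
    have "(norm (L (x n) - pt_b B L (\<mu> n) (x n) (v n)))\<^sup>2 =
        \<mu> n * (inverse (\<mu> n) * (norm (L (x n) - pt_b B L (\<mu> n) (x n) (v n)))\<^sup>2)"
      using pos[of n] by simp
    also have "\<dots> \<le> 1 / \<epsilon> * \<sigma> n"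
      using pos[of n] \<mu>_le[of n] \<epsilon> unfolding \<sigma>_def cut_depth_def by (intro mult_mono) auto
    finally show "(norm (L (x n) - pt_b B L (\<mu> n) (x n) (v n)))\<^sup>2 \<le> 1 / \<epsilon> * \<sigma> n" .
  qed simp
  have "(norm (dir_s A B L (\<gamma> n) (\<mu> n) (x n) (v n)))\<^sup>2 \<le> C * \<sigma> n"
    and "(norm (dir_t A B L (\<gamma> n) (\<mu> n) (x n) (v n)))\<^sup>2 \<le> C * \<sigma> n" for n
    using tau[of n] zero_le_power2[of "norm (dir_s A B L (\<gamma> n) (\<mu> n) (x n) (v n))"]
      zero_le_power2[of "norm (dir_t A B L (\<gamma> n) (\<mu> n) (x n) (v n))"]
    unfolding tau_def by linarith+
  then have s: "summable (\<lambda>n. (norm (dir_s A B L (\<gamma> n) (\<mu> n) (x n) (v n)))\<^sup>2)"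
    and t: "summable (\<lambda>n. (norm (dir_t A B L (\<gamma> n) (\<mu> n) (x n) (v n)))\<^sup>2)"
    by (auto intro: by_\<sigma>[of _ C])
  have incr': "(norm (z (Suc n) - z n))\<^sup>2 = (norm (x (Suc n) - x n))\<^sup>2 + (norm (v (Suc n) - v n))\<^sup>2" for n
    by (simp add: z power2_norm_eq_inner)
  have dx: "summable (\<lambda>n. (norm (x (Suc n) - x n))\<^sup>2)"
    and dv: "summable (\<lambda>n. (norm (v (Suc n) - v n))\<^sup>2)"
    by (rule summable_comparison_test'[OF incr]; simp add: incr')+
  have proj: "(xbar, vbar) \<in> ?Z"
    "\<And>w. w \<in> ?Z \<Longrightarrow> (w - (xbar, vbar)) \<bullet> ((x0, v0) - (xbar, vbar)) \<le> 0"
    unfolding assms(5) by (rule projection_properties[OF kuhn_tucker_set_closed_convex ne], assumption?)+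
  have "z \<longlonglongrightarrow> (xbar, vbar)"
  proof (rule tendsto_projection[OF proj bound[OF proj(1)]])
    fix w
    assume "w \<notin> ?Z"
    define R where "R = norm (x0, v0) + norm ((x0, v0) - (xbar, vbar))"
    have R: "norm (z n) \<le> R" for n
      using bound[OF proj(1), of n] norm_triangle_ineq2[of "z n" "(x0, v0)"]
      by (simp add: R_def norm_minus_commute)
    have "norm (x n) \<le> R" "norm (v n) \<le> R" for n
      using order_trans[OF norm_fst_le R[unfolded z]] order_trans[OF norm_snd_le R[unfolded z]] .
    from asymptotically_kuhn_tucker[OF \<epsilon> \<gamma>_ge \<mu>_ge this
        summable_power2_imp_tendsto_zero[OF a] summable_power2_imp_tendsto_zero[OF b] \<open>w \<notin> ?Z\<close>]
    show "\<exists>S. closed S \<and> convex S \<and> w \<notin> S \<and> (\<forall>\<^sub>F n in sequentially. z n \<in> S)"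
      by (simp add: z)
  qed
  then have "x \<longlonglongrightarrow> xbar" "v \<longlonglongrightarrow> vbar"
    unfolding x_def v_def using tendsto_fst tendsto_snd by fastforce+
  with it a b s t dx dv show ?thesis
    unfolding z by blast
qed

end
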